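(* For every $n\ge1$, the number of self-dual e-trees with $n$ vertices (up to isomorphism) is equal to the $(n-1)$-th Euler up/down number.
   Context: An e-tree with $n$ vertices is a tree with $n$ vertices whose $n-1$ edges are labeled bijectively by $\{1,\dots,n-1\}$; e-trees are considered up to isomorphisms preserving edge labels (vertices are unlabeled). For a vertex $v$ of an e-tree $t$ the minimally increasing greedy trail (migt) $\overrightarrow{v}$ starts at $v$ along the smallest-labeled edge at $v$; after arriving at a vertex $w$ along an edge $e$ it continues with the smallest-labeled edge at $w$ larger than $e$, and stops if there is none (for the one-vertex tree it is the trivial trail). Every edge belongs to exactly two migts. The mind-body dual $t^*$ is the e-tree whose vertices are the migts $\overrightarrow{v}$ of $t$, with an edge labeled $i$ joining the two migts that contain the edge of $t$ labeled $i$. An e-tree is self-dual if $t^*=t$, i.e. $t^*$ and $t$ are isomorphic as edge-labeled trees. The $k$-th Euler up/down number is the number of alternating permutations $a_1<a_2>a_3<\cdots$ of $[k]$ (sequence A000111: $1,1,1,2,5,16,\dots$ for $k=0,1,2,3,4,5,\dots$). *)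

theory Defs
  imports "HOL-Combinatorics.Multiset_Permutations"
begin

section \<open>Trees\<close>

text \<open>Finite simple graphs are given by a vertex set and a set of two-element edges.  The
  directed notion \<open>tree\<close> of the AFP entry Graph Theory does not fit: there an undirected edge,
  represented by two opposite arcs, is already a cycle.\<close>

definition simple_graph :: "'a set \<Rightarrow> 'a set set \<Rightarrow> bool" where
  "simple_graph V E \<longleftrightarrow> finite V \<and> (\<forall>e\<in>E. e \<subseteq> V \<and> card e = 2)"

definition graph_connected :: "'a set \<Rightarrow> 'a set set \<Rightarrow> bool" where
  "graph_connected V E \<longleftrightarrow> V \<noteq> {} \<and> (\<forall>u\<in>V. \<forall>v\<in>V. (u, v) \<in> {(x, y). {x, y} \<in> E}\<^sup>*)"

definition graph_cycle :: "'a set set \<Rightarrow> 'a list \<Rightarrow> bool" where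
  "graph_cycle E p \<longleftrightarrow> length p \<ge> 3 \<and> distinct p \<and>
     (\<forall>i<length p. {p ! i, p ! (Suc i mod length p)} \<in> E)"

definition is_tree :: "'a set \<Rightarrow> 'a set set \<Rightarrow> bool" where
  "is_tree V E \<longleftrightarrow> simple_graph V E \<and> graph_connected V E \<and> (\<nexists>p. graph_cycle E p)"


section \<open>Edge-labelled trees\<close>

text \<open>The edge labelled \<open>i\<close> is \<open>ends t i\<close>; the values of \<open>ends t\<close> outside
  \<open>labels t = {1..n-1}\<close> carry no meaning and are ignored by all notions below.\<close>

record 'a etree =
  verts :: "'a set"
  ends :: "nat \<Rightarrow> 'a set"

definition labels :: "'a etree \<Rightarrow> nat set" where
  "labels t = {1..card (verts t) - 1}"

text \<open>The labelling is bijective onto the edge set by \<open>inj_on\<close>.\<close>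

definition is_etree :: "'a etree \<Rightarrow> bool" where
  "is_etree t \<longleftrightarrow> is_tree (verts t) (ends t ` labels t) \<and> inj_on (ends t) (labels t)"

definition etree_iso :: "'a etree \<Rightarrow> 'b etree \<Rightarrow> bool" where
  "etree_iso t t' \<longleftrightarrow>
     (\<exists>f. bij_betw f (verts t) (verts t') \<and> (\<forall>i\<in>labels t. ends t' i = f ` ends t i))"


section \<open>Minimally increasing greedy trails and the mind-body dual\<close>

text \<open>\<open>greedy t k v\<close> lists the steps (edge label, vertex reached) of the greedy trail that is
  currently at \<open>v\<close> and may only use labels larger than \<open>k\<close>.\<close>

function greedy :: "'a etree \<Rightarrow> nat \<Rightarrow> 'a \<Rightarrow> (nat \<times> 'a) list" where
  "greedy t k v =
     (let S = {i \<in> labels t. k < i \<and> v \<in> ends t i}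
      in if S = {} then []
         else (let i = Min S; w = (THE w. ends t i = {v, w}) in (i, w) # greedy t i w))"
  by pat_completeness auto
termination
proof (relation "Wellfounded.measure (\<lambda>(t, k, v). card (verts t) - k)", goal_cases)
  case 1
  show ?case by simp
next
  case (2 t k v S i w)
  have "finite S" using 2(1) by (simp add: labels_def)
  then have "i \<in> S" using 2(2,3) Min_in by metis
  then show ?case using 2(1) by (auto simp: labels_def)
qed

declare greedy.simps [simp del]

text \<open>A trail is its starting vertex together with its steps, so that the two traversals of the
  single edge of the two-vertex tree are different trails.  Since labels are positive, the bound
  \<open>0\<close> is no restriction on the first edge.\<close>

definition migt :: "'a etree \<Rightarrow> 'a \<Rightarrow> 'a \<times> (nat \<times> 'a) list" where
  "migt t v = (v, greedy t 0 v)"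

definition trail_labels :: "'a \<times> (nat \<times> 'a) list \<Rightarrow> nat set" where
  "trail_labels m = fst ` set (snd m)"

definition dual :: "'a etree \<Rightarrow> ('a \<times> (nat \<times> 'a) list) etree" where
  "dual t = \<lparr>verts = migt t ` verts t,
             ends = (\<lambda>i. {m \<in> migt t ` verts t. i \<in> trail_labels m})\<rparr>"

definition self_dual :: "'a etree \<Rightarrow> bool" where
  "self_dual t \<longleftrightarrow> etree_iso (dual t) t"


section \<open>The two sides of the enumeration\<close>

text \<open>Natural numbers serve as a universe of vertex names; every e-tree is isomorphic to one with
  vertices in it.\<close>

definition self_dual_etrees :: "nat \<Rightarrow> nat etree set" where
  "self_dual_etrees n = {t. is_etree t \<and> card (verts t) = n \<and> self_dual t}"

definition self_dual_iso_classes :: "nat \<Rightarrow> nat etree set set" where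
  "self_dual_iso_classes n =
     self_dual_etrees n //
       {(t, t'). t \<in> self_dual_etrees n \<and> t' \<in> self_dual_etrees n \<and> etree_iso t t'}"

text \<open>List positions start at \<open>0\<close>, so \<open>xs ! i\<close> is \<open>a\<^sub>i\<^sub>+\<^sub>1\<close>.\<close>

definition alternating :: "nat list \<Rightarrow> bool" where
  "alternating xs \<longleftrightarrow> (\<forall>i. Suc i < length xs \<longrightarrow>
     (if even i then xs ! i < xs ! Suc i else xs ! i > xs ! Suc i))"

definition euler_up_down :: "nat \<Rightarrow> nat" where
  "euler_up_down k = card {xs \<in> permutations_of_set {1..k}. alternating xs}"

end

theory Submission
  imports Defs "HOL-Computational_Algebra.Formal_Power_Series"
begin

text \<open>Build an e-tree by inserting its edges from the largest label to the smallest.  An edge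
  \<open>i = {a, b}\<close> whose label is smaller than all labels present joins two trees and changes only two
  trails: the one from \<open>a\<close> now starts with \<open>i\<close> and goes on as the old trail from \<open>b\<close>, and
  vice versa.  Record each vertex by the pair of its star (the labels of the edges at it) and the
  label set of its trail.  Joining two trees then replaces one pair \<open>(A, A')\<close> of the first and one
  pair \<open>(B, B')\<close> of the second by \<open>(A + i, B' + i)\<close> and \<open>(B + i, A' + i)\<close> and keeps
  all other pairs.  The multiset of these pairs, the profile of the tree, determines the tree up to
  isomorphism by its first components alone (\<open>etree_iso_if_stars\<close>).  The stars of the dual
  are the trail sets, so a tree is self-dual iff the two projections of its profile are the same
  multiset (\<open>self_dual_iff\<close>).

  In a self-dual profile that arises by joining, comparing the two projections forces both parts to
  be self-dual and \<open>A = A'\<close>, \<open>B = B'\<close> (\<open>glue_at_roots_onto\<close>).  Call a star fixed if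
  it is paired with itself.  Self-dual trees thus arise exactly by joining two self-dual trees at
  fixed stars, and with at least two edges the two parts are determined up to their order
  (\<open>glue_at_roots_eq_cases\<close>).  A join uses up the two fixed stars at its ends, which gives by
  induction that a self-dual tree with an even number of edges has one fixed star and one with an
  odd number has none or two, counted with multiplicity (\<open>num_fixed_parity\<close>).

  Let \<open>R m\<close> be the number of self-dual trees with \<open>m\<close> edges and a chosen fixed star, and let
  \<open>T m\<close> be the number of self-dual trees with \<open>m\<close> edges.  For \<open>m \<ge> 1\<close>, distributing the
  \<open>m\<close> larger labels over the two parts gives
  \<open>2 T (m + 1) = (\<Sum>k\<le>m. (m choose k) R k R (m - k))\<close>.  The fixed stars of the join are those of
  the parts other than the two roots: one from each part with an odd number of edges, none from the
  other parts.  Hence, by the symmetry \<open>k \<mapsto> m - k\<close>,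
  \<open>R (m + 1) = (\<Sum>k odd. (m choose k) R k R (m - k))\<close>.  Cutting an alternating permutation at
  its maximum leaves an odd number of entries to the left, so the Euler numbers satisfy the same
  recurrence and \<open>R\<close> is the Euler sequence (\<open>card_rooted_profiles\<close>).  To pass to \<open>T\<close>,
  let \<open>t\<close> and \<open>s\<close> be the odd and even parts of the exponential generating function of the
  Euler numbers.  The recurrence says \<open>t' = 1 + t\<^sup>2\<close> and \<open>s' = t s\<close>, so
  \<open>s\<^sup>2 = 1 + t\<^sup>2\<close> (the tangent and the secant), and this turns the full convolution into
  twice the one over odd \<open>k\<close> (\<open>zigzag_convolution\<close>).\<close>


section \<open>The Euler up/down numbers\<close>

lemma sum_Pow_card:
  fixes f :: "nat \<Rightarrow> 'b::comm_semiring_1"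
  assumes "finite K"
  shows "(\<Sum>X\<in>Pow K. f (card X)) = (\<Sum>k\<le>card K. of_nat (card K choose k) * f k)"
proof -
  have "(\<Sum>X\<in>Pow K. f (card X)) = (\<Sum>k\<le>card K. \<Sum>X\<in>{X\<in>Pow K. card X = k}. f (card X))"
    by (rule sum.group [symmetric]) (use assms in \<open>auto intro: card_mono\<close>)
  also have "\<dots> = (\<Sum>k\<le>card K. of_nat (card K choose k) * f k)"
  proof (rule sum.cong [OF refl])
    fix k
    have "(\<Sum>X\<in>{X\<in>Pow K. card X = k}. f (card X)) = (\<Sum>X\<in>{X\<in>Pow K. card X = k}. f k)"
      by (rule sum.cong) auto
    also have "\<dots> = of_nat (card {X. X \<subseteq> K \<and> card X = k}) * f k" by simp
    finally show "(\<Sum>X\<in>{X\<in>Pow K. card X = k}. f (card X)) = of_nat (card K choose k) * f k"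
      by (simp add: n_subsets [OF assms])
  qed
  finally show ?thesis .
qed

text \<open>Cutting an alternating permutation of \<open>m + 1\<close> numbers at its maximum: \<open>k\<close> is the
  number of entries to the left of the maximum.  It is odd except for \<open>m = 0\<close>, when there are no
  other entries.\<close>

function zigzag :: "nat \<Rightarrow> nat" where
  "zigzag 0 = 1"
| "zigzag (Suc m) = (if m = 0 then 1 else
     (\<Sum>k | k \<in> {..m} \<and> odd k. (m choose k) * zigzag k * zigzag (m - k)))"
  by pat_completeness auto
termination
  by (relation "Wellfounded.measure id") (auto simp: odd_pos less_Suc_eq_le)

declare zigzag.simps(2) [simp del]

lemma zigzag_Suc:
  "zigzag (Suc m) = (if m = 0 then 1 else 0) +
     (\<Sum>k\<le>m. (m choose k) * (if odd k then zigzag k else 0) * zigzag (m - k))"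
proof -
  have "(\<Sum>k | k \<in> {..m} \<and> odd k. (m choose k) * zigzag k * zigzag (m - k)) =
        (\<Sum>k\<le>m. (m choose k) * (if odd k then zigzag k else 0) * zigzag (m - k))"
    by (rule sum.mono_neutral_cong_left) auto
  then show ?thesis by (simp add: zigzag.simps(2))
qed

text \<open>When \<open>m\<close> is even, \<open>k\<close> and \<open>m - k\<close> are odd together, so the recurrence is the
  equation \<open>t' = 1 + t\<^sup>2\<close> between coefficients; when \<open>m\<close> is odd it is \<open>s' = t s\<close>.\<close>

lemma zigzag_Suc_even_part:
  assumes "even m"
  shows "zigzag (Suc m) = (if m = 0 then 1 else 0) +
     (\<Sum>k\<le>m. (m choose k) * (if odd k then zigzag k else 0) *
        (if odd (m - k) then zigzag (m - k) else 0))"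
  unfolding zigzag_Suc using assms by (intro arg_cong2 [where f = "(+)"] sum.cong) auto

lemma zigzag_Suc_odd_part:
  assumes "odd m"
  shows "zigzag (Suc m) =
     (\<Sum>k\<le>m. (m choose k) * (if odd k then zigzag k else 0) *
        (if even (m - k) then zigzag (m - k) else 0))"
proof -
  have "m \<noteq> 0" using assms by (auto elim: oddE)
  then show ?thesis
  unfolding zigzag_Suc using assms by (auto intro!: sum.cong)
qed

definition egf :: "(nat \<Rightarrow> nat) \<Rightarrow> rat fps" where
  "egf a = Abs_fps (\<lambda>n. of_nat (a n) / fact n)"

lemma egf_nth: "fps_nth (egf a) n = of_nat (a n) / fact n"
  by (simp add: egf_def)

lemma egf_mult: "egf a * egf b = egf (\<lambda>m. \<Sum>k\<le>m. (m choose k) * a k * b (m - k))"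
proof (rule fps_ext)
  fix m
  have "of_nat (a k) / fact k * (of_nat (b (m - k)) / fact (m - k)) =
      (of_nat ((m choose k) * a k * b (m - k)) / fact m :: rat)" if "k \<le> m" for k
    using that by (simp add: binomial_fact field_simps)
  then have "(\<Sum>k\<le>m. of_nat (a k) / fact k * (of_nat (b (m - k)) / fact (m - k))) =
      (\<Sum>k\<le>m. of_nat ((m choose k) * a k * b (m - k)) / fact m :: rat)"
    by (intro sum.cong) auto
  then show "fps_nth (egf a * egf b) m = fps_nth (egf (\<lambda>m. \<Sum>k\<le>m. (m choose k) * a k * b (m - k))) m"
    by (simp add: fps_mult_nth egf_nth atLeast0AtMost sum_divide_distrib)
qed

lemma egf_deriv: "fps_deriv (egf a) = egf (\<lambda>m. a (Suc m))"
  by (rule fps_ext) (simp add: egf_nth del: of_nat_Suc)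

lemma egf_add: "egf a + egf b = egf (\<lambda>m. a m + b m)"
  by (rule fps_ext) (simp add: egf_nth field_simps)

lemma egf_one: "1 = egf (\<lambda>m. if m = 0 then 1 else 0)"
  by (rule fps_ext) (simp add: egf_nth)

text \<open>Coefficient \<open>m\<close> of the equation expresses coefficient \<open>m + 1\<close> of \<open>D\<close> by
  earlier ones, so the whole series vanishes with its constant term.\<close>

lemma fps_linear_ode_zero:
  fixes D :: "rat fps"
  assumes "fps_deriv D = c * D" "fps_nth D 0 = 0"
  shows "D = 0"
proof (rule fps_ext)
  fix n
  show "fps_nth D n = fps_nth 0 n"
  proof (induction n rule: less_induct)
    case (less n)
    show ?case
    proof (cases n)
      case (Suc m)
      have "of_nat (Suc m) * fps_nth D (Suc m) = fps_nth (c * D) m"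
        using arg_cong [OF assms(1), of "\<lambda>F. fps_nth F m"] by simp
      also have "\<dots> = 0" using less Suc by (auto simp: fps_mult_nth intro!: sum.neutral)
      finally show ?thesis using Suc by simp
    qed (use assms in simp)
  qed
qed

text \<open>With \<open>t\<close> and \<open>s\<close> the odd and even parts of the generating function \<open>f\<close>, the series
  \<open>s\<^sup>2 - t\<^sup>2 - 1\<close> solves a homogeneous linear equation and starts with \<open>0\<close>.  Therefore
  \<open>2 f' = 2 (1 + t (s + t))\<close> equals \<open>1 + (s + t)\<^sup>2\<close>, which is the claim for the coefficients.\<close>

lemma zigzag_convolution:
  assumes "m > 0"
  shows "2 * zigzag (Suc m) = (\<Sum>k\<le>m. (m choose k) * zigzag k * zigzag (m - k))"
proof -
  define T where "T = egf (\<lambda>n. if odd n then zigzag n else 0)"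
  define S where "S = egf (\<lambda>n. if even n then zigzag n else 0)"
  have T': "fps_deriv T = 1 + T * T"
    unfolding T_def egf_deriv egf_mult egf_one egf_add
    by (rule arg_cong [where f = egf], rule ext) (auto simp: zigzag_Suc_even_part intro!: sum.neutral)
  have S': "fps_deriv S = T * S"
    unfolding T_def S_def egf_deriv egf_mult
    by (rule arg_cong [where f = egf], rule ext) (auto simp: zigzag_Suc_odd_part intro!: sum.neutral)
  \<comment> \<open>The Pythagorean identity between secant and tangent says that this series vanishes.\<close>
  define D where "D = S * S - T * T - 1"
  have "fps_deriv D = 2 * T * D"
    by (simp add: D_def T' S' algebra_simps)
  moreover have "fps_nth D 0 = 0"
    by (simp add: D_def S_def T_def egf_nth)
  ultimately have "D = 0" by (rule fps_linear_ode_zero)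
  then have pyth: "S * S = 1 + T * T" by (simp add: D_def algebra_simps)
  have Z: "egf zigzag = S + T"
    unfolding S_def T_def egf_add by (rule arg_cong [where f = egf]) auto
  have "2 * fps_deriv (egf zigzag) = 1 + egf zigzag * egf zigzag"
    unfolding Z by (simp add: T' S' algebra_simps pyth)
  from arg_cong [OF this, of "\<lambda>F. fps_nth F m"]
  have "of_nat (2 * zigzag (Suc m)) / (fact m :: rat) =
     of_nat (\<Sum>k\<le>m. (m choose k) * zigzag k * zigzag (m - k)) / fact m"
    using assms by (simp add: egf_deriv egf_mult egf_nth numeral_fps_const)
  then have "(of_nat (2 * zigzag (Suc m)) :: rat) =
     of_nat (\<Sum>k\<le>m. (m choose k) * zigzag k * zigzag (m - k))"
    by (simp add: field_simps)
  then show ?thesis using of_nat_eq_iff by blast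
qed

text \<open>The maximum can only stand at a peak, that is at an odd position counted from \<open>0\<close>; the
  entries after it then begin with a valley, as the entries before it do.  A list consisting of its
  maximum alone is the exception that the second assumption excludes.\<close>

lemma alternating_split_max:
  assumes "\<And>x. x \<in> set ys \<union> set zs \<Longrightarrow> x < M" "ys \<noteq> [] \<or> zs \<noteq> []"
  shows "alternating (ys @ M # zs) \<longleftrightarrow> odd (length ys) \<and> alternating ys \<and> alternating zs"
proof
  assume alt: "alternating (ys @ M # zs)"
  have *: "(even i \<longrightarrow> (ys @ M # zs) ! i < (ys @ M # zs) ! Suc i) \<and>
      (odd i \<longrightarrow> (ys @ M # zs) ! i > (ys @ M # zs) ! Suc i)" if "Suc i < length ys + Suc (length zs)" for i
    using alt that by (simp add: alternating_def)
  have odd_len: "odd (length ys)"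
  proof (cases ys rule: rev_cases)
    case Nil
    then have "zs \<noteq> []" using assms(2) by simp
    then have "M < zs ! 0" "zs ! 0 < M" using *[of 0] Nil assms(1) by auto
    then show ?thesis by simp
  next
    case (snoc us u)
    then have "u < M" using assms(1) by auto
    moreover have "odd (length us) \<longrightarrow> u > M"
      using *[of "length us"] snoc by (simp add: nth_append)
    ultimately show ?thesis using snoc by auto
  qed
  have "alternating ys"
    unfolding alternating_def
  proof (intro allI impI)
    fix i assume i: "Suc i < length ys"
    then have "Suc i < length ys + Suc (length zs)" by simp
    from *[OF this] i show "if even i then ys ! i < ys ! Suc i else ys ! Suc i < ys ! i"
      by (simp add: nth_append)
  qed
  moreover have "alternating zs"
    unfolding alternating_def
  proof (intro allI impI)
    fix i assume i: "Suc i < length zs"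
    then have "Suc (Suc (length ys) + i) < length ys + Suc (length zs)" by simp
    from *[OF this] odd_len show "if even i then zs ! i < zs ! Suc i else zs ! Suc i < zs ! i"
      by (simp add: nth_append)
  qed
  ultimately show "odd (length ys) \<and> alternating ys \<and> alternating zs" using odd_len by simp
next
  assume R: "odd (length ys) \<and> alternating ys \<and> alternating zs"
  show "alternating (ys @ M # zs)"
    unfolding alternating_def
  proof (intro allI impI)
    fix i assume i: "Suc i < length (ys @ M # zs)"
    consider "Suc i < length ys" | "Suc i = length ys" | "i = length ys" | "i > length ys" by linarith
    then show "if even i then (ys @ M # zs) ! i < (ys @ M # zs) ! Suc i
        else (ys @ M # zs) ! Suc i < (ys @ M # zs) ! i"
    proof cases
      case 1
      then show ?thesis using R by (auto simp: alternating_def nth_append)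
    next
      case 2
      then have "even i" using R by (metis even_Suc)
      then show ?thesis using 2 assms(1) by (auto simp: nth_append)
    next
      case 3
      then show ?thesis using R i assms(1) by (auto simp: nth_append)
    next
      case 4
      then obtain j where j: "i = Suc (length ys) + j" by (metis less_iff_Suc_add add_Suc_right add_Suc)
      then have "Suc j < length zs" using i by simp
      then show ?thesis using R j by (auto simp: alternating_def nth_append)
    qed
  qed
qed

lemma card_alternating_permutations:
  "finite S \<Longrightarrow> card {xs \<in> permutations_of_set S. alternating xs} = zigzag (card S)"
proof (induction S rule: finite_psubset_induct)
  case (psubset S)
  define Q where "Q = (\<lambda>S::nat set. {xs \<in> permutations_of_set S. alternating xs})"
  have fin: "finite (Q X)" if "finite X" for X using that by (simp add: Q_def)
  have IH: "card (Q X) = zigzag (card X)" if "X \<subset> S" for X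
    using psubset that by (simp add: Q_def)
  show ?case
  proof (cases "S = {}")
    case True
    then have "{xs \<in> permutations_of_set S. alternating xs} = {[]}" by (auto simp: alternating_def)
    then show ?thesis using True by simp
  next
    case False
    define M where "M = Max S"
    define K where "K = S - {M}"
    have MS: "M \<in> S" using False psubset by (simp add: M_def)
    have lt: "x < M" if "x \<in> K" for x
      using that psubset unfolding K_def M_def by (simp add: order.strict_iff_order)
    have SK: "S = insert M K" "M \<notin> K" "finite K" "card S = Suc (card K)"
      using MS psubset card.remove [OF _ MS] by (auto simp: K_def)
    show ?thesis
    proof (cases "K = {}")
      case True
      then have "{xs \<in> permutations_of_set S. alternating xs} = {[M]}"
        using SK by (auto simp: alternating_def)
      then show ?thesis using True SK by (simp add: zigzag_Suc)
    next
      case K: False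
      define G where "G = (SIGMA X:{X \<in> Pow K. odd (card X)}. Q X \<times> Q (K - X))"
      have sub: "X \<subset> S" "K - X \<subset> S" if "X \<subseteq> K" for X using that SK by auto
      have "bij_betw (\<lambda>(X, ys, zs). ys @ M # zs) G (Q S)"
        unfolding bij_betw_def
      proof
        show "inj_on (\<lambda>(X, ys, zs). ys @ M # zs) G"
        proof (rule inj_onI, clarsimp simp: G_def Q_def)
          fix X ys zs X' ys' zs'
          assume h: "X \<subseteq> K" "X' \<subseteq> K" "ys @ M # zs = ys' @ M # zs'"
            "ys \<in> permutations_of_set X" "ys' \<in> permutations_of_set X'"
            "zs \<in> permutations_of_set (K - X)"
          then have "M \<notin> set ys" "M \<notin> set zs" using SK by (auto simp: permutations_of_set_def)
          then have "ys = ys' \<and> zs = zs'"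
            using h(3) by (simp add: append_Cons_eq_iff)
          then show "X = X' \<and> ys = ys' \<and> zs = zs'" using h by (auto simp: permutations_of_set_def)
        qed
        show "(\<lambda>(X, ys, zs). ys @ M # zs) ` G = Q S"
        proof (intro equalityI subsetI)
          fix xs assume "xs \<in> (\<lambda>(X, ys, zs). ys @ M # zs) ` G"
          then obtain X ys zs where h: "X \<subseteq> K" "odd (card X)" "ys \<in> Q X" "zs \<in> Q (K - X)" "xs = ys @ M # zs"
            by (auto simp: G_def)
          then have s: "set ys = X" "set zs = K - X" "distinct ys" "distinct zs" "alternating ys" "alternating zs"
            by (auto simp: Q_def permutations_of_set_def)
          then have "odd (length ys)" using h(2) by (simp add: distinct_card flip: s(1))
          then have "alternating xs"
            unfolding h(5) using s h(1) lt by (subst alternating_split_max) auto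
          moreover have "set xs = S" "distinct xs" using h s SK by auto
          ultimately show "xs \<in> Q S" by (auto simp: Q_def permutations_of_set_def)
        next
          fix xs assume xs: "xs \<in> Q S"
          then have s: "set xs = S" "distinct xs" "alternating xs" by (auto simp: Q_def permutations_of_set_def)
          obtain ys zs where yz: "xs = ys @ M # zs" using MS s(1) by (metis split_list)
          have Keq: "K = set ys \<union> set zs" "set ys \<inter> set zs = {}" using s yz SK by auto
          have "odd (length ys) \<and> alternating ys \<and> alternating zs"
            using s(3) unfolding yz
            by (subst (asm) alternating_split_max) (use Keq lt K in auto)
          then have "(set ys, ys, zs) \<in> G"
            using s yz Keq by (auto simp: G_def Q_def permutations_of_set_def distinct_card)
          then show "xs \<in> (\<lambda>(X, ys, zs). ys @ M # zs) ` G" using yz by force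
        qed
      qed
      then have "card (Q S) = card G" by (simp add: bij_betw_same_card)
      also have "\<dots> = (\<Sum>X\<in>{X \<in> Pow K. odd (card X)}. card (Q X \<times> Q (K - X)))"
        unfolding G_def
      proof (intro card_SigmaI ballI)
        fix X assume "X \<in> {X \<in> Pow K. odd (card X)}"
        then have "finite X" "finite (K - X)" using SK(3) finite_subset by auto
        then show "finite (Q X \<times> Q (K - X))" by (simp add: fin)
      qed (use SK(3) in simp)
      also have "\<dots> = (\<Sum>X\<in>{X \<in> Pow K. odd (card X)}. zigzag (card X) * zigzag (card K - card X))"
      proof (intro sum.cong refl)
        fix X assume "X \<in> {X \<in> Pow K. odd (card X)}"
        then have "X \<subseteq> K" by simp
        then show "card (Q X \<times> Q (K - X)) = zigzag (card X) * zigzag (card K - card X)"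
          using sub[of X] SK(3) by (simp add: card_cartesian_product IH card_Diff_subset finite_subset)
      qed
      also have "\<dots> = (\<Sum>X\<in>Pow K. (\<lambda>k. (if odd k then zigzag k else 0) * zigzag (card K - k)) (card X))"
        using SK(3) by (intro sum.mono_neutral_cong_left) auto
      also have "\<dots> = zigzag (Suc (card K))"
        using K SK(3)
          sum_Pow_card [OF SK(3), of "\<lambda>k. (if odd k then zigzag k else 0) * zigzag (card K - k)"]
        by (simp add: zigzag_Suc mult.assoc)
      finally show ?thesis using SK by (simp add: Q_def)
    qed
  qed
qed

lemma euler_up_down_eq_zigzag: "euler_up_down k = zigzag k"
  unfolding euler_up_down_def by (subst card_alternating_permutations) simp_all

section \<open>Profiles of edge-labelled trees\<close>

text \<open>The pairs \<open>(A, A')\<close> and \<open>(B, B')\<close> belong to the ends of the new edge \<open>i\<close>.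
  A multiset is used because the two vertices of a tree with a single edge have the same pair.\<close>

inductive profile :: "nat set \<Rightarrow> (nat set \<times> nat set) multiset \<Rightarrow> bool" where
  single: "profile {} {#({}, {})#}"
| glue: "\<lbrakk>profile L1 (add_mset (A, A') P1); profile L2 (add_mset (B, B') P2);
    L1 \<inter> L2 = {}; \<And>j. j \<in> L1 \<union> L2 \<Longrightarrow> i < j\<rbrakk> \<Longrightarrow>
    profile (insert i (L1 \<union> L2))
      (add_mset (insert i A, insert i B') (add_mset (insert i B, insert i A') (P1 + P2)))"

lemma profile_finite: "profile L P \<Longrightarrow> finite L"
  by (induction rule: profile.induct) auto

lemma profile_empty: "profile {} P \<Longrightarrow> P = {#({}, {})#}"
  by (auto elim: profile.cases)

lemma profile_subset:
  "profile L P \<Longrightarrow> (S, U) \<in># P \<Longrightarrow> S \<subseteq> L \<and> U \<subseteq> L \<and> (L \<noteq> {} \<longrightarrow> S \<noteq> {} \<and> U \<noteq> {})"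
proof (induction arbitrary: S U rule: profile.induct)
  case (glue L1 A A' P1 L2 B B' P2 i)
  have e1: "P1 = {#}" if "L1 = {}" using profile_empty glue.hyps(1) that by fastforce
  have e2: "P2 = {#}" if "L2 = {}" using profile_empty glue.hyps(2) that by fastforce
  have r: "A \<subseteq> L1" "A' \<subseteq> L1" "B \<subseteq> L2" "B' \<subseteq> L2" using glue.IH(1)[of A A'] glue.IH(2)[of B B'] by auto
  consider "(S, U) = (insert i A, insert i B')" | "(S, U) = (insert i B, insert i A')"
    | "(S, U) \<in># P1" | "(S, U) \<in># P2" using glue.prems by auto
  then show ?case
  proof cases
    case 3
    then show ?thesis using glue.IH(1)[of S U] e1 by auto
  next
    case 4
    then show ?thesis using glue.IH(2)[of S U] e2 by auto
  qed (use r in auto)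
qed auto

text \<open>Connectedness of the tree, seen from its edges: no proper nonempty set \<open>X\<close> of edges is
  separated from the others at every vertex.  This is what makes the two parts of a join
  recognisable from the profile.\<close>

lemma profile_connected:
  "profile L P \<Longrightarrow> X \<subseteq> L \<Longrightarrow> X \<noteq> {} \<Longrightarrow> X \<noteq> L \<Longrightarrow>
    \<exists>S U. (S, U) \<in># P \<and> S \<inter> X \<noteq> {} \<and> S - X \<noteq> {}"
proof (induction arbitrary: X rule: profile.induct)
  case (glue L1 A A' P1 L2 B B' P2 i)
  define P where "P = add_mset (insert i A, insert i B') (add_mset (insert i B, insert i A') (P1 + P2))"
  \<comment> \<open>A set and its complement are separated by the same stars, so the case of a set without the new edge suffices.\<close>
  have wlog: "\<exists>S U. (S, U) \<in># P \<and> S \<inter> Y \<noteq> {} \<and> S - Y \<noteq> {}"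
    if Y: "Y \<subseteq> insert i (L1 \<union> L2)" "Y \<noteq> {}" "i \<notin> Y" for Y
  proof -
    have side: "\<exists>S U. (S, U) \<in># add_mset (insert i C, D) Q \<and> S \<inter> Y \<noteq> {} \<and> S - Y \<noteq> {}"
      if meets: "Y \<inter> M \<noteq> {}" and prof: "profile M (add_mset (C, C') Q)" and
        IH: "\<And>X. X \<subseteq> M \<Longrightarrow> X \<noteq> {} \<Longrightarrow> X \<noteq> M \<Longrightarrow>
          \<exists>S U. (S, U) \<in># add_mset (C, C') Q \<and> S \<inter> X \<noteq> {} \<and> S - X \<noteq> {}" for M C C' Q D
    proof (cases "M \<subseteq> Y")
      case True
      have "C \<subseteq> M" "C \<noteq> {}" using profile_subset [OF prof, of C C'] meets by auto
      then show ?thesis using True Y(3) by auto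
    next
      case False
      then obtain S U where SU: "(S, U) \<in># add_mset (C, C') Q" "S \<inter> (Y \<inter> M) \<noteq> {}" "S - (Y \<inter> M) \<noteq> {}"
        using IH[of "Y \<inter> M"] meets by blast
      have "S \<subseteq> M" using profile_subset [OF prof SU(1)] by simp
      then have "S \<inter> Y \<noteq> {}" "S - Y \<noteq> {}" using SU(2,3) by auto
      then show ?thesis using SU(1) by auto
    qed
    have "Y \<inter> L1 \<noteq> {} \<or> Y \<inter> L2 \<noteq> {}" using Y by auto
    then show ?thesis
    proof
      assume "Y \<inter> L1 \<noteq> {}"
      from side [OF this glue.hyps(1) glue.IH(1), of "insert i B'"] show ?thesis
        unfolding P_def by auto
    next
      assume "Y \<inter> L2 \<noteq> {}"
      from side [OF this glue.hyps(2) glue.IH(2), of "insert i A'"] show ?thesis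
        unfolding P_def by auto
    qed
  qed
  show ?case
  proof (cases "i \<in> X")
    case False
    then show ?thesis using wlog[of X] glue.prems unfolding P_def by simp
  next
    case True
    define Y where "Y = insert i (L1 \<union> L2) - X"
    have "Y \<subseteq> insert i (L1 \<union> L2)" "Y \<noteq> {}" "i \<notin> Y" using True glue.prems by (auto simp: Y_def)
    then obtain S U where SU: "(S, U) \<in># P" "S \<inter> Y \<noteq> {}" "S - Y \<noteq> {}" using wlog by blast
    have "profile (insert i (L1 \<union> L2)) P" unfolding P_def by (rule profile.glue) (use glue.hyps in auto)
    then have "S \<subseteq> insert i (L1 \<union> L2)" using profile_subset SU(1) by blast
    then have "S \<inter> X \<noteq> {}" "S - X \<noteq> {}" using SU(2,3) unfolding Y_def by auto
    then show ?thesis using SU(1) unfolding P_def by blast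
  qed
qed auto

definition self_dual_profiles :: "nat set \<Rightarrow> (nat set \<times> nat set) multiset set" where
  "self_dual_profiles L = {P. profile L P \<and> image_mset fst P = image_mset snd P}"

definition fixed_stars :: "(nat set \<times> nat set) multiset \<Rightarrow> nat set set" where
  "fixed_stars P = {A. (A, A) \<in># P}"

text \<open>The inductive rule for profiles in the case \<open>A = A'\<close> and \<open>B = B'\<close>, which is the only
  one that yields self-dual profiles.\<close>

definition glue_at_roots :: "nat \<Rightarrow> (nat set \<times> (nat set \<times> nat set) multiset \<times> nat set) \<times>
    (nat set \<times> (nat set \<times> nat set) multiset \<times> nat set) \<Rightarrow> (nat set \<times> nat set) multiset" where
  "glue_at_roots i = (\<lambda>((L1, P1, A), (L2, P2, B)).
     add_mset (insert i A, insert i B) (add_mset (insert i B, insert i A)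
       ((P1 - {#(A, A)#}) + (P2 - {#(B, B)#}))))"

definition rooted_profiles :: "nat set \<Rightarrow> (nat set \<times> (nat set \<times> nat set) multiset \<times> nat set) set" where
  "rooted_profiles L = {L} \<times> (SIGMA P:self_dual_profiles L. fixed_stars P)"

definition rooted_pairs :: "nat set \<Rightarrow> ((nat set \<times> (nat set \<times> nat set) multiset \<times> nat set) \<times>
    (nat set \<times> (nat set \<times> nat set) multiset \<times> nat set)) set" where
  "rooted_pairs K = (\<Union>X\<in>Pow K. rooted_profiles X \<times> rooted_profiles (K - X))"

lemma self_dual_profiles_empty: "self_dual_profiles {} = {{#({}, {})#}}"
  by (auto simp: self_dual_profiles_def dest: profile_empty intro: profile.single)

lemma rooted_pairsE:
  assumes "g \<in> rooted_pairs K"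
  obtains X P1 A P2 B where "g = ((X, P1, A), (K - X, P2, B))" "X \<subseteq> K"
    "P1 \<in> self_dual_profiles X" "(A, A) \<in># P1" "P2 \<in> self_dual_profiles (K - X)" "(B, B) \<in># P2"
  using assms by (auto simp: rooted_pairs_def rooted_profiles_def fixed_stars_def)

lemma self_dual_profilesD: "P \<in> self_dual_profiles L \<Longrightarrow> profile L P"
  by (simp add: self_dual_profiles_def)

lemma filter_mset_eq_self: "(\<And>x. x \<in># N \<Longrightarrow> p x) \<Longrightarrow> filter_mset p N = N"
  by (simp add: filter_mset_eq_conv)

lemma glue_at_roots_in:
  assumes "g \<in> rooted_pairs K" "\<And>j. j \<in> K \<Longrightarrow> i < j"
  shows "glue_at_roots i g \<in> self_dual_profiles (insert i K)"
proof -
  from assms(1) obtain X P1 A P2 B where g: "g = ((X, P1, A), (K - X, P2, B))" "X \<subseteq> K"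
    "P1 \<in> self_dual_profiles X" "(A, A) \<in># P1" "P2 \<in> self_dual_profiles (K - X)" "(B, B) \<in># P2"
    by (rule rooted_pairsE)
  obtain Q1 Q2 where Q: "P1 = add_mset (A, A) Q1" "P2 = add_mset (B, B) Q2"
    using g by (meson multi_member_split)
  have "profile (insert i (X \<union> (K - X)))
      (add_mset (insert i A, insert i B) (add_mset (insert i B, insert i A) (Q1 + Q2)))"
    by (rule profile.glue) (use g Q assms(2) in \<open>auto simp: self_dual_profiles_def\<close>)
  moreover have "X \<union> (K - X) = K" using g(2) by auto
  ultimately show ?thesis using g Q by (simp add: self_dual_profiles_def glue_at_roots_def)
qed

text \<open>All stars and trail sets of the first part that avoid \<open>i\<close> are nonempty subsets of \<open>L1\<close>,
  those of the second part nonempty subsets of \<open>L2\<close>.  Equality of the two projections can hence be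
  tested on the parts separately, and what is left is
  \<open>{A + i, B + i} = {B' + i, A' + i}\<close> as multisets.  The crossed solution \<open>A = B'\<close>, \<open>B = A'\<close>
  is possible only if all four sets are empty, because \<open>L1\<close> and \<open>L2\<close> are disjoint.\<close>

lemma glue_at_roots_onto:
  assumes "P \<in> self_dual_profiles (insert i K)" "\<And>j. j \<in> K \<Longrightarrow> i < j"
  shows "P \<in> glue_at_roots i ` rooted_pairs K"
proof -
  have sd: "image_mset fst P = image_mset snd P" using assms(1) by (simp add: self_dual_profiles_def)
  from assms(1) have "profile (insert i K) P" by (simp add: self_dual_profiles_def)
  then show ?thesis
  proof (cases rule: profile.cases)
    case (glue L1 A A' P1 L2 B B' P2 i')
    have "i' = i"
    proof (rule ccontr)
      assume "i' \<noteq> i"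
      then have "i' \<in> K" "i \<in> L1 \<union> L2" using glue(1) by auto
      then show False using assms(2) glue(6) by fastforce
    qed
    have iK: "i \<notin> K" "i \<notin> L1 \<union> L2" using assms(2) glue(6) \<open>i' = i\<close> by auto
    have K: "K = L1 \<union> L2" using glue(1) \<open>i' = i\<close> iK by auto
    have sub1: "S \<subseteq> L1 \<and> U \<subseteq> L1 \<and> S \<noteq> {} \<and> U \<noteq> {}" if "(S, U) \<in># P1" for S U
    proof -
      have "L1 \<noteq> {}" using profile_empty glue(3) that by fastforce
      then show ?thesis using profile_subset [OF glue(3), of S U] that by auto
    qed
    have sub2: "S \<subseteq> L2 \<and> U \<subseteq> L2 \<and> S \<noteq> {} \<and> U \<noteq> {}" if "(S, U) \<in># P2" for S U
    proof -
      have "L2 \<noteq> {}" using profile_empty glue(4) that by fastforce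
      then show ?thesis using profile_subset [OF glue(4), of S U] that by auto
    qed
    have root1: "A \<subseteq> L1" "A' \<subseteq> L1" "A = {} \<longleftrightarrow> L1 = {}" "A' = {} \<longleftrightarrow> L1 = {}"
      using profile_subset [OF glue(3), of A A'] by auto
    have root2: "B \<subseteq> L2" "B' \<subseteq> L2" "B = {} \<longleftrightarrow> L2 = {}" "B' = {} \<longleftrightarrow> L2 = {}"
      using profile_subset [OF glue(4), of B B'] by auto
    have eq: "add_mset (insert i A) (add_mset (insert i B) (image_mset fst P1 + image_mset fst P2)) =
      add_mset (insert i B') (add_mset (insert i A') (image_mset snd P1 + image_mset snd P2))"
      using sd glue(2) \<open>i' = i\<close> by simp
    have in1: "S \<subseteq> L1 \<and> S \<noteq> {}" if "S \<in># image_mset fst P1 \<or> S \<in># image_mset snd P1" for S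
      using sub1 that by fastforce
    have in2: "S \<subseteq> L2 \<and> S \<noteq> {}" if "S \<in># image_mset fst P2 \<or> S \<in># image_mset snd P2" for S
      using sub2 that by fastforce
    \<comment> \<open>Filtering the equation for the whole profile by inclusion in one label set isolates that part.\<close>
    define F1 where "F1 = filter_mset (\<lambda>S. S \<subseteq> L1)"
    define F2 where "F2 = filter_mset (\<lambda>S. S \<subseteq> L2)"
    have none: "filter_mset p N = {#}" if "\<And>x. x \<in># N \<Longrightarrow> \<not> p x" for p and N :: "nat set multiset"
      using that by simp
    have n1: "\<not> S \<subseteq> L2" if "S \<subseteq> L1" "S \<noteq> {}" for S using that glue(5) by auto
    have n2: "\<not> S \<subseteq> L1" if "S \<subseteq> L2" "S \<noteq> {}" for S using that glue(5) by auto
    have F1: "F1 (image_mset fst P1) = image_mset fst P1" "F1 (image_mset snd P1) = image_mset snd P1"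
      "F1 (image_mset fst P2) = {#}" "F1 (image_mset snd P2) = {#}"
      unfolding F1_def by (rule filter_mset_eq_self none; use in1 in2 n2 in blast)+
    have F2: "F2 (image_mset fst P2) = image_mset fst P2" "F2 (image_mset snd P2) = image_mset snd P2"
      "F2 (image_mset fst P1) = {#}" "F2 (image_mset snd P1) = {#}"
      unfolding F2_def by (rule filter_mset_eq_self none; use in1 in2 n1 in blast)+
    have sd1: "image_mset fst P1 = image_mset snd P1"
      using arg_cong [OF eq, of F1] F1 iK(2) by (simp add: F1_def del: filter_mset_eq_mempty_iff)
    have sd2: "image_mset fst P2 = image_mset snd P2"
      using arg_cong [OF eq, of F2] F2 iK(2) by (simp add: F2_def del: filter_mset_eq_mempty_iff)
    have "{#insert i A, insert i B#} = {#insert i B', insert i A'#}"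
      using eq unfolding sd1 sd2 by simp
    then have "(insert i A = insert i B' \<and> insert i B = insert i A') \<or>
      (insert i A = insert i A' \<and> insert i B = insert i B')"
      by (auto simp: add_eq_conv_ex)
    moreover have "insert i C = insert i D \<longleftrightarrow> C = D" if "C \<subseteq> K" "D \<subseteq> K" for C D
      using that iK by (metis Diff_insert_absorb in_mono)
    ultimately have "(A = B' \<and> B = A') \<or> (A = A' \<and> B = B')"
      using root1 root2 K by (metis sup.coboundedI1 sup.coboundedI2)
    then have AB: "A = A'" "B = B'"
      using root1 root2 glue(5) by blast+
    define g where "g = ((L1, add_mset (A, A) P1, A), (L2, add_mset (B, B) P2, B))"
    have "K - L1 = L2" using K glue(5) by auto
    then have "g \<in> rooted_pairs K"
      unfolding g_def rooted_pairs_def rooted_profiles_def self_dual_profiles_def fixed_stars_def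
      using glue(3,4) AB sd1 sd2 K by auto
    moreover have "P = glue_at_roots i g"
      using glue(2) \<open>i' = i\<close> AB by (simp add: g_def glue_at_roots_def)
    ultimately show ?thesis by blast
  qed simp
qed

lemma glue_at_roots_image:
  assumes "\<And>j. j \<in> K \<Longrightarrow> i < j"
  shows "glue_at_roots i ` rooted_pairs K = self_dual_profiles (insert i K)"
  using glue_at_roots_in glue_at_roots_onto assms by blast

lemma finite_self_dual_profiles: "finite L \<Longrightarrow> finite (self_dual_profiles L)"
proof (induction L rule: finite_psubset_induct)
  case (psubset L)
  show ?case
  proof (cases "L = {}")
    case False
    define K where "K = L - {Min L}"
    have "Min L \<in> L" using False psubset by simp
    then have L: "L = insert (Min L) K" "finite K" using psubset by (auto simp: K_def)
    have lt: "Min L < j" if "j \<in> K" for j using that psubset by (simp add: K_def order.strict_iff_order)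
    have "finite (rooted_profiles X)" if "X \<subseteq> K" for X
    proof -
      have "X \<subset> L" using that L lt by auto
      moreover have "finite (fixed_stars P)" for P
        by (rule finite_subset [of _ "fst ` set_mset P"]) (force simp: fixed_stars_def)+
      ultimately show ?thesis unfolding rooted_profiles_def
        by (auto intro!: finite_SigmaI psubset.IH)
    qed
    then have "finite (rooted_pairs K)" using L(2) by (auto simp: rooted_pairs_def)
    then have "finite (glue_at_roots (Min L) ` rooted_pairs K)" by simp
    then show ?thesis using glue_at_roots_image[of K "Min L"] lt L(1) by simp
  qed (simp add: self_dual_profiles_empty)
qed

text \<open>Once the label set \<open>X\<close> of a part is known, the part is read off from the join: its pairs are
  those with a star that meets \<open>X\<close>, up to restoring the root.  The root is cut out of the stars
  at \<open>i\<close> by \<open>X\<close>.  A part without edges has an empty star that meets nothing and is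
  treated separately.\<close>

lemma glue_at_roots_recover:
  assumes "profile X P1" "(A, A) \<in># P1" "profile Y P2" "(B, B) \<in># P2" "X \<inter> Y = {}" "i \<notin> X \<union> Y"
  defines "P \<equiv> glue_at_roots i ((X, P1, A), (Y, P2, B))"
  shows "A = \<Union>{S. \<exists>U. (S, U) \<in># P \<and> i \<in> S} \<inter> X"
    and "P1 = (if X = {} then {#({}, {})#} else
      image_mset (\<lambda>(S, U). if i \<in> S then (S \<inter> X, S \<inter> X) else (S, U)) (filter_mset (\<lambda>(S, U). S \<inter> X \<noteq> {}) P))"
proof -
  obtain Q1 Q2 where Q: "P1 = add_mset (A, A) Q1" "P2 = add_mset (B, B) Q2"
    using assms by (meson multi_member_split)
  have P: "P = add_mset (insert i A, insert i B) (add_mset (insert i B, insert i A) (Q1 + Q2))"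
    by (simp add: P_def glue_at_roots_def Q)
  have s1: "S \<subseteq> X" "X \<noteq> {} \<Longrightarrow> S \<noteq> {}" if "(S, U) \<in># P1" for S U
    using profile_subset [OF assms(1) that] by auto
  have s2: "S \<subseteq> Y" if "(S, U) \<in># P2" for S U
    using profile_subset [OF assms(3) that] by auto
  have A: "A \<subseteq> X" and B: "B \<subseteq> Y" using s1 s2 assms(2,4) by auto
  have stars_i: "{S. \<exists>U. (S, U) \<in># P \<and> i \<in> S} = {insert i A, insert i B}"
  proof -
    have "i \<notin> S" if "(S, U) \<in># Q1 + Q2" for S U using s1[of S U] s2[of S U] assms(6) that Q by auto
    then show ?thesis by (auto simp: P)
  qed
  have "\<Union>{insert i A, insert i B} \<inter> X = A"
    using A B assms(5,6) by blast
  then show "A = \<Union>{S. \<exists>U. (S, U) \<in># P \<and> i \<in> S} \<inter> X"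
    unfolding stars_i by (rule sym)
  show "P1 = (if X = {} then {#({}, {})#} else
      image_mset (\<lambda>(S, U). if i \<in> S then (S \<inter> X, S \<inter> X) else (S, U)) (filter_mset (\<lambda>(S, U). S \<inter> X \<noteq> {}) P))"
  proof (cases "X = {}")
    case True
    then show ?thesis using assms(1) profile_empty by simp
  next
    case False
    have Q1: "S \<noteq> {}" "S \<inter> X \<noteq> {}" "i \<notin> S" if "(S, U) \<in># Q1" for S U
      using s1 [of S U] that False assms(6) unfolding Q by auto
    have Q2: "S \<inter> X = {}" if "(S, U) \<in># Q2" for S U
      using s2 [of S U] that assms(5) unfolding Q by auto
    have 1: "filter_mset (\<lambda>(S, U). S \<inter> X \<noteq> {}) Q1 = Q1"
      by (rule filter_mset_eq_self) (use Q1(2) in blast)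
    have 2: "filter_mset (\<lambda>(S, U). S \<inter> X \<noteq> {}) Q2 = {#}"
      using Q2 by auto
    have "image_mset (\<lambda>(S, U). if i \<in> S then (S \<inter> X, S \<inter> X) else (S, U)) Q1 = image_mset id Q1"
      by (rule image_mset_cong) (use Q1(3) in auto)
    then have 3: "image_mset (\<lambda>(S, U). if i \<in> S then (S \<inter> X, S \<inter> X) else (S, U)) Q1 = Q1" by simp
    have 4: "insert i A \<inter> X = A" "A \<noteq> {}" "insert i B \<inter> X = {}"
      using A B s1 [OF assms(2)] False assms(5,6) by auto
    show ?thesis using False 1 2 3 4 by (simp add: P Q)
  qed
qed

lemma glue_at_roots_inject:
  assumes "profile X P1" "(A, A) \<in># P1" "profile Y P2" "(B, B) \<in># P2"
    and "profile X P1'" "(A', A') \<in># P1'" "profile Y P2'" "(B', B') \<in># P2'"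
    and "X \<inter> Y = {}" "i \<notin> X \<union> Y"
    and eq: "glue_at_roots i ((X, P1, A), (Y, P2, B)) = glue_at_roots i ((X, P1', A'), (Y, P2', B'))"
  shows "P1' = P1 \<and> A' = A"
proof -
  note r = glue_at_roots_recover [OF assms(1-4,9,10)] and r' = glue_at_roots_recover [OF assms(5-8,9,10)]
  show ?thesis
    using trans [OF r'(1) r(1) [unfolded eq, symmetric]] trans [OF r'(2) r(2) [unfolded eq, symmetric]]
    by (intro conjI)
qed

lemma glue_at_roots_commute: "glue_at_roots i (prod.swap g) = glue_at_roots i g"
proof -
  obtain X P A Y Q B where g: "g = ((X, P, A), (Y, Q, B))" by (metis prod.collapse)
  show ?thesis unfolding g by (simp add: glue_at_roots_def add_mset_commute add.commute)
qed

lemma glue_at_roots_star_subset: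
  assumes "profile X P1" "(A, A) \<in># P1" "profile Y P2" "(B, B) \<in># P2"
    and "(S, U) \<in># glue_at_roots i ((X, P1, A), (Y, P2, B))"
  shows "S - {i} \<subseteq> X \<or> S - {i} \<subseteq> Y"
proof -
  have "A \<subseteq> X" "B \<subseteq> Y" using profile_subset assms(1-4) by blast+
  moreover consider "S = insert i A" | "S = insert i B" | "(S, U) \<in># P1" | "(S, U) \<in># P2"
    using assms(5) unfolding glue_at_roots_def by (auto dest: in_diffD)
  ultimately show ?thesis
    using profile_subset [OF assms(1), of S U] profile_subset [OF assms(3), of S U]
    by cases blast+
qed

text \<open>Both decompositions partition \<open>K\<close> in such a way that each star, apart from \<open>i\<close>, lies
  in one block.  By connectedness a part of one decomposition cannot be cut by the partition of the
  other, so the two partitions have the same blocks, and the parts are recovered from their label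
  sets.\<close>

lemma glue_at_roots_eq_cases:
  assumes g: "g \<in> rooted_pairs K" and h: "h \<in> rooted_pairs K" and eq: "glue_at_roots i g = glue_at_roots i h"
    and lt: "\<And>j. j \<in> K \<Longrightarrow> i < j"
  shows "h = g \<or> h = prod.swap g"
proof -
  obtain X P1 A P2 B where g': "g = ((X, P1, A), (K - X, P2, B))" "X \<subseteq> K"
    "profile X P1" "(A, A) \<in># P1" "profile (K - X) P2" "(B, B) \<in># P2"
    using g by (elim rooted_pairsE) (blast dest: self_dual_profilesD)
  obtain X' P1' A' P2' B' where h': "h = ((X', P1', A'), (K - X', P2', B'))" "X' \<subseteq> K"
    "profile X' P1'" "(A', A') \<in># P1'" "profile (K - X') P2'" "(B', B') \<in># P2'"
    using h by (elim rooted_pairsE) (blast dest: self_dual_profilesD)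
  have iK: "i \<notin> K" using lt by auto
  have separate: "X \<inter> X' = {} \<or> X \<subseteq> X'"
    if prof: "profile X P1" "(A, A) \<in># P1" and XK: "X \<subseteq> K"
      and in': "\<And>S U. (S, U) \<in># glue_at_roots i ((X, P1, A), Z) \<Longrightarrow> S - {i} \<subseteq> X' \<or> S - {i} \<subseteq> K - X'"
    for X P1 A X' Z
  proof (rule ccontr)
    assume "\<not> ?thesis"
    then have "X \<inter> X' \<subseteq> X" "X \<inter> X' \<noteq> {}" "X \<inter> X' \<noteq> X" by auto
    from profile_connected [OF prof(1) this] obtain S U where
      SU: "(S, U) \<in># P1" "S \<inter> (X \<inter> X') \<noteq> {}" "S - (X \<inter> X') \<noteq> {}" by auto
    have "S \<subseteq> X" using profile_subset [OF prof(1) SU(1)] by simp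
    obtain U' T where "(T, U') \<in># glue_at_roots i ((X, P1, A), Z)" "T - {i} = S"
    proof (cases "(S, U) = (A, A)")
      case True
      obtain L2 P2 B where "Z = (L2, P2, B)" by (cases Z)
      then have "(insert i S, insert i B) \<in># glue_at_roots i ((X, P1, A), Z)"
        using True by (simp add: glue_at_roots_def)
      moreover have "insert i S - {i} = S" using \<open>S \<subseteq> X\<close> XK iK by auto
      ultimately show ?thesis using that by blast
    next
      case False
      obtain Q1 where "P1 = add_mset (A, A) Q1" using prof(2) by (meson multi_member_split)
      then have "(S, U) \<in># P1 - {#(A, A)#}" using SU(1) False by auto
      then have "(S, U) \<in># glue_at_roots i ((X, P1, A), Z)" by (auto simp: glue_at_roots_def split: prod.split)
      moreover have "S - {i} = S" using \<open>S \<subseteq> X\<close> XK iK by auto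
      ultimately show ?thesis using that by blast
    qed
    then have "S \<subseteq> X' \<or> S \<subseteq> K - X'" using in' by metis
    then show False using SU \<open>S \<subseteq> X\<close> by auto
  qed
  let ?P = "glue_at_roots i g"
  have in_g: "S - {i} \<subseteq> X \<or> S - {i} \<subseteq> K - X" if "(S, U) \<in># ?P" for S U
    using glue_at_roots_star_subset [OF g'(3-6)] that unfolding g'(1) by blast
  have in_h: "S - {i} \<subseteq> X' \<or> S - {i} \<subseteq> K - X'" if "(S, U) \<in># ?P" for S U
    using glue_at_roots_star_subset [OF h'(3-6)] that unfolding eq h'(1) by blast
  have gs: "?P = glue_at_roots i ((K - X, P2, B), (X, P1, A))" "?P = glue_at_roots i ((X, P1, A), (K - X, P2, B))"
    using glue_at_roots_commute[of i g] g'(1) by simp_all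
  have hs: "?P = glue_at_roots i ((K - X', P2', B'), (X', P1', A'))" "?P = glue_at_roots i ((X', P1', A'), (K - X', P2', B'))"
    using glue_at_roots_commute[of i h] h'(1) eq by simp_all
  have s1: "X \<inter> X' = {} \<or> X \<subseteq> X'"
    by (rule separate [OF g'(3,4,2) in_h [unfolded gs(2)]])
  have s2: "(K - X) \<inter> X' = {} \<or> K - X \<subseteq> X'"
    by (rule separate [OF g'(5,6) Diff_subset in_h [unfolded gs(1)]])
  have s3: "X' \<inter> X = {} \<or> X' \<subseteq> X"
    by (rule separate [OF h'(3,4,2) in_g [unfolded hs(2)]])
  have s4: "(K - X') \<inter> X = {} \<or> K - X' \<subseteq> X"
    by (rule separate [OF h'(5,6) Diff_subset in_g [unfolded hs(1)]])
  have "X' = X \<or> X' = K - X"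
  proof (cases "X \<inter> X' = {}")
    case True
    then show ?thesis using s2 s4 g'(2) h'(2) by blast
  next
    case False
    then show ?thesis using s1 s3 by blast
  qed
  then show ?thesis
  proof
    assume X: "X' = X"
    have d: "X \<inter> (K - X) = {}" "i \<notin> X \<union> (K - X)" "(K - X) \<inter> X = {}" "i \<notin> (K - X) \<union> X" using iK g'(2) by auto
    have "P1' = P1 \<and> A' = A"
      by (rule glue_at_roots_inject [OF g'(3-6) h'(3-6) [unfolded X] d(1,2)])
        (use gs(2) hs(2) X in simp)
    moreover have "P2' = P2 \<and> B' = B"
      by (rule glue_at_roots_inject [OF g'(5,6,3,4) h'(5,6,3,4) [unfolded X] d(3,4)])
        (use gs(1) hs(1) X in simp)
    ultimately show ?thesis using X g'(1) h'(1) by simp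
  next
    assume X: "X' = K - X"
    then have X2: "K - X' = X" using g'(2) by auto
    have d: "X \<inter> (K - X) = {}" "i \<notin> X \<union> (K - X)" "(K - X) \<inter> X = {}" "i \<notin> (K - X) \<union> X" using iK g'(2) by auto
    have "P2' = P1 \<and> B' = A"
      by (rule glue_at_roots_inject [OF g'(3-6) h'(5,6,3,4) [unfolded X2, unfolded X] d(1,2)])
        (use gs(2) hs(1) X X2 in simp)
    moreover have "P1' = P2 \<and> A' = B"
      by (rule glue_at_roots_inject [OF g'(5,6,3,4) h'(3-6) [unfolded X2, unfolded X] d(3,4)])
        (use gs(1) hs(2) X X2 in simp)
    ultimately show ?thesis using X X2 g'(1) h'(1) by simp
  qed
qed

section \<open>Counting self-dual profiles\<close>

lemma finite_fixed_stars: "finite (fixed_stars P)"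
  by (rule finite_subset [of _ "fst ` set_mset P"]) (force simp: fixed_stars_def)+

lemma finite_rooted_profiles: "finite L \<Longrightarrow> finite (rooted_profiles L)"
  by (auto simp: rooted_profiles_def intro!: finite_SigmaI finite_self_dual_profiles finite_fixed_stars)

lemma finite_rooted_pairs: "finite K \<Longrightarrow> finite (rooted_pairs K)"
  by (auto simp: rooted_pairs_def intro!: finite_cartesian_product finite_rooted_profiles intro: finite_subset)

text \<open>Joining is two-to-one: each self-dual profile comes from a pair of rooted profiles and from the
  swapped pair, and these differ because their label sets are disjoint and not both empty.\<close>

lemma sum_rooted_pairs_glue:
  fixes h :: "(nat set \<times> nat set) multiset \<Rightarrow> nat"
  assumes "finite K" "K \<noteq> {}" "\<And>j. j \<in> K \<Longrightarrow> i < j"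
  shows "(\<Sum>g\<in>rooted_pairs K. h (glue_at_roots i g)) = 2 * (\<Sum>P\<in>self_dual_profiles (insert i K). h P)"
proof -
  have fib: "card {g \<in> rooted_pairs K. glue_at_roots i g = P} = 2" if "P \<in> self_dual_profiles (insert i K)" for P
  proof -
    from glue_at_roots_onto [OF that assms(3)] obtain g where g: "g \<in> rooted_pairs K" "glue_at_roots i g = P" by blast
    obtain X P1 A P2 B where g': "g = ((X, P1, A), (K - X, P2, B))" "X \<subseteq> K"
      "P1 \<in> self_dual_profiles X" "(A, A) \<in># P1" "P2 \<in> self_dual_profiles (K - X)" "(B, B) \<in># P2"
      using g(1) by (rule rooted_pairsE)
    have KX: "K - (K - X) = X" using g'(2) by auto
    have "prod.swap g \<in> rooted_pairs K"
      unfolding rooted_pairs_def rooted_profiles_def fixed_stars_def g'(1)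
      by (rule UN_I [of "K - X"]) (use g' KX in auto)
    moreover have "glue_at_roots i (prod.swap g) = P" using g glue_at_roots_commute by metis
    moreover have "h = g \<or> h = prod.swap g" if "h \<in> rooted_pairs K" "glue_at_roots i h = P" for h
      by (rule glue_at_roots_eq_cases [OF g(1) that(1) _ assms(3)]) (use g(2) that(2) in auto)
    ultimately have "{g \<in> rooted_pairs K. glue_at_roots i g = P} = {g, prod.swap g}"
      using g by blast
    moreover have "g \<noteq> prod.swap g" using g' assms(2) by auto
    ultimately show ?thesis by simp
  qed
  have "(\<Sum>g\<in>rooted_pairs K. h (glue_at_roots i g)) =
      (\<Sum>P\<in>self_dual_profiles (insert i K). \<Sum>g\<in>{g \<in> rooted_pairs K. glue_at_roots i g = P}. h (glue_at_roots i g))"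
    by (rule sum.group [symmetric])
      (use assms in \<open>auto intro: finite_rooted_pairs finite_self_dual_profiles glue_at_roots_in\<close>)
  also have "\<dots> = (\<Sum>P\<in>self_dual_profiles (insert i K). 2 * h P)"
    by (intro sum.cong) (simp_all add: fib)
  finally show ?thesis by (simp add: sum_distrib_left)
qed

text \<open>Fixed stars counted with multiplicity.  In contrast to the number of different fixed stars, this
  is \<open>2\<close> for the tree with a single edge, which makes the parity rule below uniform.\<close>

definition num_fixed :: "(nat set \<times> nat set) multiset \<Rightarrow> nat" where
  "num_fixed P = size (filter_mset (\<lambda>(S, U). S = U) P)"

lemma card_fixed_stars:
  assumes "num_fixed P \<le> 1"
  shows "card (fixed_stars P) = num_fixed P"
proof -
  have eq: "fixed_stars P = fst ` set_mset (filter_mset (\<lambda>(S, U). S = U) P)"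
    by (force simp: fixed_stars_def)
  consider "num_fixed P = 0" | "num_fixed P = 1" using assms by linarith
  then show ?thesis
  proof cases
    case 1
    then have "filter_mset (\<lambda>(S, U). S = U) P = {#}"
      unfolding num_fixed_def by (simp only: size_eq_0_iff_empty)
    then show ?thesis unfolding eq 1 by (simp only: set_mset_empty image_empty card.empty)
  next
    case 2
    then obtain x where "filter_mset (\<lambda>(S, U). S = U) P = {#x#}"
      unfolding num_fixed_def by (meson size_1_singleton_mset)
    then show ?thesis unfolding eq 2 by simp
  qed
qed

text \<open>Equal roots of disjoint parts would be empty, hence both parts would be single vertices.\<close>

lemma rooted_stars_distinct:
  assumes "profile X P1" "(A, A) \<in># P1" "profile (K - X) P2" "(B, B) \<in># P2" "K \<noteq> {}" "X \<subseteq> K" "i \<notin> K"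
  shows "insert i A \<noteq> insert i B"
proof
  assume eq: "insert i A = insert i B"
  have AB: "A \<subseteq> X" "B \<subseteq> K - X" using profile_subset assms(1-4) by blast+
  then have "i \<notin> A" "i \<notin> B" using assms(6,7) by auto
  then have "A = B" using eq by (simp add: insert_ident)
  then have "A = {}" "B = {}" using AB by auto
  then have "X = {}" "K - X = {}" using profile_subset assms(1-4) by blast+
  then show False using assms(5) by simp
qed

lemma num_fixed_glue:
  assumes "profile X P1" "(A, A) \<in># P1" "profile (K - X) P2" "(B, B) \<in># P2" "K \<noteq> {}" "X \<subseteq> K" "i \<notin> K"
  shows "num_fixed (glue_at_roots i ((X, P1, A), (K - X, P2, B))) = (num_fixed P1 - 1) + (num_fixed P2 - 1)"
    and "num_fixed P1 \<ge> 1" "num_fixed P2 \<ge> 1"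
proof -
  obtain Q1 Q2 where Q: "P1 = add_mset (A, A) Q1" "P2 = add_mset (B, B) Q2"
    using assms by (meson multi_member_split)
  note ne = rooted_stars_distinct [OF assms]
  show "num_fixed (glue_at_roots i ((X, P1, A), (K - X, P2, B))) = (num_fixed P1 - 1) + (num_fixed P2 - 1)"
    using ne ne [symmetric] by (simp add: num_fixed_def glue_at_roots_def Q)
  show "num_fixed P1 \<ge> 1" "num_fixed P2 \<ge> 1" by (simp_all add: num_fixed_def Q)
qed

lemma rooted_pairs_empty: "rooted_pairs {} = {(({}, {#({}, {})#}, {}), ({}, {#({}, {})#}, {}))}"
  by (auto simp: rooted_pairs_def rooted_profiles_def self_dual_profiles_empty fixed_stars_def)

lemma self_dual_profiles_single: "self_dual_profiles {i} = {{#({i}, {i}), ({i}, {i})#}}"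
  using glue_at_roots_image [of "{}" i] by (simp add: rooted_pairs_empty glue_at_roots_def)

lemma split_off_Min:
  fixes L :: "nat set"
  assumes "finite L" "L \<noteq> {}"
  obtains i K where "L = insert i K" "finite K" "i \<notin> K" "\<And>j. j \<in> K \<Longrightarrow> i < j"
proof
  show "L = insert (Min L) (L - {Min L})" using assms Min_in by blast
  show "Min L < j" if "j \<in> L - {Min L}" for j
    using that assms by (simp add: order.strict_iff_order)
qed (use assms in auto)

text \<open>A join loses the two fixed stars at its ends, unless it joins two single vertices.  A part that
  has a fixed star at all has one or two according to parity, and the sum of the remaining ones has
  the claimed value for the number \<open>1 + |X| + |K - X|\<close> of edges.\<close>

lemma num_fixed_parity:
  "finite L \<Longrightarrow> P \<in> self_dual_profiles L \<Longrightarrow> if even (card L) then num_fixed P = 1 else num_fixed P \<in> {0, 2}"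
proof (induction L arbitrary: P rule: finite_psubset_induct)
  case (psubset L)
  show ?case
  proof (cases "L = {}")
    case True
    then show ?thesis using psubset.prems by (auto simp: self_dual_profiles_empty num_fixed_def)
  next
    case False
    then obtain i K where L: "L = insert i K" "finite K" "i \<notin> K" "\<And>j. j \<in> K \<Longrightarrow> i < j"
      using psubset.hyps split_off_Min by metis
    show ?thesis
    proof (cases "K = {}")
      case True
      then show ?thesis using psubset.prems L by (auto simp: self_dual_profiles_single num_fixed_def)
    next
      case K: False
      from psubset.prems L obtain g where g: "g \<in> rooted_pairs K" "glue_at_roots i g = P"
        using glue_at_roots_onto by (metis imageE)
      obtain X P1 A P2 B where g': "g = ((X, P1, A), (K - X, P2, B))" "X \<subseteq> K"
        "P1 \<in> self_dual_profiles X" "(A, A) \<in># P1" "P2 \<in> self_dual_profiles (K - X)" "(B, B) \<in># P2"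
        using g(1) by (rule rooted_pairsE)
      note nf = num_fixed_glue [OF self_dual_profilesD [OF g'(3)] g'(4) self_dual_profilesD [OF g'(5)] g'(6) K g'(2) L(3)]
      have "X \<subset> L" "K - X \<subset> L" using L g'(2) by auto
      note IH = psubset.IH [OF this(1) g'(3)] psubset.IH [OF this(2) g'(5)]
      have "card L = Suc (card X + card (K - X))"
        using L g'(2) by (simp add: card_Diff_subset finite_subset card_mono)
      then show ?thesis
        using IH nf g(2) unfolding g'(1) by (auto split: if_splits)
    qed
  qed
qed

text \<open>After its root is removed, a part with an odd number of edges has exactly one fixed star left
  and a part with an even number has none.\<close>

lemma card_fixed_stars_glue:
  assumes g: "g \<in> rooted_pairs K" and K: "finite K" "K \<noteq> {}" "i \<notin> K"
  shows "card (fixed_stars (glue_at_roots i g)) =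
    of_bool (odd (card (fst (fst g)))) + of_bool (odd (card K - card (fst (fst g))))"
proof -
  obtain X P1 A P2 B where g': "g = ((X, P1, A), (K - X, P2, B))" "X \<subseteq> K"
    "P1 \<in> self_dual_profiles X" "(A, A) \<in># P1" "P2 \<in> self_dual_profiles (K - X)" "(B, B) \<in># P2"
    using g by (rule rooted_pairsE)
  have prof: "profile X P1" "profile (K - X) P2" using g' self_dual_profilesD by blast+
  obtain Q1 Q2 where Q: "P1 = add_mset (A, A) Q1" "P2 = add_mset (B, B) Q2"
    using g' by (meson multi_member_split)
  have ne: "insert i A \<noteq> insert i B"
    using rooted_stars_distinct prof g' K by blast
  have fin: "finite X" "finite (K - X)" using K g'(2) finite_subset by auto
  have nf: "num_fixed Q1 = of_bool (odd (card X))" "num_fixed Q2 = of_bool (odd (card (K - X)))"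
    using num_fixed_parity [OF fin(1) g'(3)] num_fixed_parity [OF fin(2) g'(5)]
    by (auto simp: num_fixed_def Q split: if_splits)
  have "fixed_stars (glue_at_roots i g) = fixed_stars Q1 \<union> fixed_stars Q2"
    unfolding g'(1) fixed_stars_def using ne by (auto simp: glue_at_roots_def Q)
  moreover have "fixed_stars Q1 \<inter> fixed_stars Q2 = {}"
  proof (rule ccontr)
    assume "\<not> ?thesis"
    then obtain S where S: "(S, S) \<in># Q1" "(S, S) \<in># Q2" by (auto simp: fixed_stars_def)
    then have "S \<subseteq> X" "S \<subseteq> K - X" using profile_subset prof Q by (metis insert_iff set_mset_add_mset_insert)+
    then have "S = {}" by auto
    then have "X = {}" using profile_subset [OF prof(1), of S S] S Q by auto
    then have "P1 = {#({}, {})#}" using prof(1) profile_empty by simp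
    then show False using S Q by auto
  qed
  ultimately have "card (fixed_stars (glue_at_roots i g)) = num_fixed Q1 + num_fixed Q2"
    using card_fixed_stars [of Q1] card_fixed_stars [of Q2] nf
    by (simp add: card_Un_disjoint finite_fixed_stars)
  moreover have "card (K - X) = card K - card X" using fin(1) g'(2) by (simp add: card_Diff_subset)
  ultimately show ?thesis using nf by (simp add: g'(1))
qed

lemma sum_rooted_pairs:
  fixes w :: "nat \<Rightarrow> nat"
  assumes K: "finite K" and R: "\<And>X. X \<subseteq> K \<Longrightarrow> card (rooted_profiles X) = z (card X)"
  shows "(\<Sum>g\<in>rooted_pairs K. w (card (fst (fst g)))) =
    (\<Sum>k\<le>card K. (card K choose k) * (w k * z k * z (card K - k)))"
proof -
  have "(\<Sum>g\<in>rooted_pairs K. w (card (fst (fst g)))) =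
      (\<Sum>X\<in>Pow K. \<Sum>g\<in>rooted_profiles X \<times> rooted_profiles (K - X). w (card (fst (fst g))))"
    unfolding rooted_pairs_def
  proof (rule sum.UNION_disjoint)
    show "\<forall>X\<in>Pow K. finite (rooted_profiles X \<times> rooted_profiles (K - X))"
    proof
      fix X assume "X \<in> Pow K"
      then have "finite X" "finite (K - X)" using K finite_subset by auto
      then show "finite (rooted_profiles X \<times> rooted_profiles (K - X))" by (simp add: finite_rooted_profiles)
    qed
  qed (use K in \<open>auto simp: rooted_profiles_def\<close>)
  also have "\<dots> = (\<Sum>X\<in>Pow K. (\<lambda>k. w k * z k * z (card K - k)) (card X))"
  proof (intro sum.cong refl)
    fix X assume "X \<in> Pow K"
    then have X: "X \<subseteq> K" by simp
    have "(\<Sum>g\<in>rooted_profiles X \<times> rooted_profiles (K - X). w (card (fst (fst g)))) =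
        (\<Sum>g\<in>rooted_profiles X \<times> rooted_profiles (K - X). w (card X))"
      by (intro sum.cong) (auto simp: rooted_profiles_def)
    also have "\<dots> = w (card X) * z (card X) * z (card K - card X)"
      using R [OF X] R [of "K - X"] X K
      by (simp add: card_cartesian_product card_Diff_subset finite_subset mult_ac)
    finally show "(\<Sum>g\<in>rooted_profiles X \<times> rooted_profiles (K - X). w (card (fst (fst g)))) =
        (\<lambda>k. w k * z k * z (card K - k)) (card X)" by simp
  qed
  also have "\<dots> = (\<Sum>k\<le>card K. (card K choose k) * (w k * z k * z (card K - k)))"
    by (subst sum_Pow_card [OF K]) simp
  finally show ?thesis .
qed

lemma card_rooted_profiles_eq_sum: "finite L \<Longrightarrow> card (rooted_profiles L) = (\<Sum>P\<in>self_dual_profiles L. card (fixed_stars P))"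
  unfolding rooted_profiles_def
  by (simp add: card_cartesian_product finite_self_dual_profiles finite_fixed_stars card_SigmaI)

text \<open>Both parities of \<open>k\<close> contribute equally after the reflection \<open>k \<mapsto> m - k\<close>, so the
  count obeys the recurrence of \<open>zigzag\<close>.\<close>

lemma card_rooted_profiles: "finite L \<Longrightarrow> card (rooted_profiles L) = zigzag (card L)"
proof (induction L rule: finite_psubset_induct)
  case (psubset L)
  show ?case
  proof (cases "L = {}")
    case True
    then show ?thesis
      by (simp add: card_rooted_profiles_eq_sum self_dual_profiles_empty card_fixed_stars num_fixed_def)
  next
    case False
    then obtain i K where L: "L = insert i K" "finite K" "i \<notin> K" "\<And>j. j \<in> K \<Longrightarrow> i < j"
      using psubset.hyps split_off_Min by metis
    show ?thesis
    proof (cases "K = {}")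
      case True
      have "fixed_stars {#({i}, {i}), ({i}, {i})#} = {{i}}" by (auto simp: fixed_stars_def)
      then show ?thesis using True L by (simp add: card_rooted_profiles_eq_sum self_dual_profiles_single zigzag_Suc)
    next
      case K: False
      let ?m = "card K"
      have IH: "card (rooted_profiles X) = zigzag (card X)" if "X \<subseteq> K" for X
        using psubset.IH [of X] that L by auto
      have "2 * card (rooted_profiles L) = (\<Sum>g\<in>rooted_pairs K. card (fixed_stars (glue_at_roots i g)))"
        using sum_rooted_pairs_glue [OF L(2) K L(4), of "\<lambda>P. card (fixed_stars P)"] L by (simp add: card_rooted_profiles_eq_sum)
      also have "\<dots> = (\<Sum>g\<in>rooted_pairs K.
          of_bool (odd (card (fst (fst g)))) + of_bool (odd (?m - card (fst (fst g)))))"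
        by (intro sum.cong refl card_fixed_stars_glue) (use L K in auto)
      also have "\<dots> = (\<Sum>k\<le>?m. (?m choose k) *
          ((of_bool (odd k) + of_bool (odd (?m - k))) * zigzag k * zigzag (?m - k)))"
        by (rule sum_rooted_pairs [OF L(2) IH])
      also have "\<dots> = (\<Sum>k\<le>?m. (?m choose k) * (of_bool (odd k) * zigzag k * zigzag (?m - k))) +
          (\<Sum>k\<le>?m. (?m choose k) * (of_bool (odd (?m - k)) * zigzag k * zigzag (?m - k)))"
        by (simp add: sum.distrib algebra_simps)
      also have "(\<Sum>k\<le>?m. (?m choose k) * (of_bool (odd (?m - k)) * zigzag k * zigzag (?m - k))) =
          (\<Sum>k\<le>?m. (?m choose k) * (of_bool (odd k) * zigzag k * zigzag (?m - k)))"
        by (rule sum.reindex_bij_witness [of _ "\<lambda>k. ?m - k" "\<lambda>k. ?m - k"])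
          (auto simp: binomial_symmetric [symmetric] mult_ac)
      also have "(\<Sum>k\<le>?m. (?m choose k) * (of_bool (odd k) * zigzag k * zigzag (?m - k))) = zigzag (Suc ?m)"
        unfolding zigzag_Suc using K L(2) by (auto simp: of_bool_def split: if_splits intro!: sum.cong)
      finally show ?thesis using L by simp
    qed
  qed
qed

text \<open>Each self-dual profile with at least two edges is counted twice among the rooted pairs, and
  their number is the full convolution of the Euler numbers.\<close>

lemma card_self_dual_profiles:
  assumes "finite L"
  shows "card (self_dual_profiles L) = zigzag (card L)"
proof (cases "L = {}")
  case True
  then show ?thesis by (simp add: self_dual_profiles_empty)
next
  case False
  then obtain i K where L: "L = insert i K" "finite K" "i \<notin> K" "\<And>j. j \<in> K \<Longrightarrow> i < j"
    using assms split_off_Min by metis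
  show ?thesis
  proof (cases "K = {}")
    case True
    then show ?thesis using L by (simp add: self_dual_profiles_single zigzag_Suc)
  next
    case K: False
    have R: "card (rooted_profiles X) = zigzag (card X)" if "X \<subseteq> K" for X
      using card_rooted_profiles that L(2) finite_subset by blast
    have "2 * card (self_dual_profiles L) = (\<Sum>g\<in>rooted_pairs K. 1)"
      using sum_rooted_pairs_glue [OF L(2) K L(4), of "\<lambda>_. 1"] L by simp
    also have "\<dots> = 2 * zigzag (card L)"
      using sum_rooted_pairs [OF L(2) R, of "\<lambda>_. 1"] zigzag_convolution [of "card K"] K L
      by (simp add: card_gt_0_iff mult.assoc)
    finally show ?thesis by simp
  qed
qed

section \<open>Profiles of forests\<close>

text \<open>The list \<open>xs\<close> enumerates the labels of a forest in increasing order, so a single pass through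
  it follows the greedy trail: the walker moves along every edge that is at its current vertex when
  the label of that edge is reached.\<close>

fun trail_set :: "(nat \<Rightarrow> 'a set) \<Rightarrow> nat list \<Rightarrow> 'a \<Rightarrow> nat set" where
  "trail_set e [] v = {}"
| "trail_set e (i # is) v =
     (if v \<in> e i then insert i (trail_set e is (THE w. e i = {v, w})) else trail_set e is v)"

definition vertex_profile :: "(nat \<Rightarrow> 'a set) \<Rightarrow> nat list \<Rightarrow> 'a \<Rightarrow> nat set \<times> nat set" where
  "vertex_profile e xs v = ({j \<in> set xs. v \<in> e j}, trail_set e xs v)"

definition forest_profile :: "(nat \<Rightarrow> 'a set) \<Rightarrow> nat list \<Rightarrow> 'a set \<Rightarrow> (nat set \<times> nat set) multiset" where
  "forest_profile e xs V = image_mset (vertex_profile e xs) (mset_set V)"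

lemma other_end:
  "(THE w. {a, b} = {a, w}) = b" "(THE w. {a, b} = {b, w}) = a"
  by (auto simp: doubleton_eq_iff)

lemma card_2_other_end: "card A = 2 \<Longrightarrow> v \<in> A \<Longrightarrow> \<exists>w. A = {v, w}"
  by (auto simp: card_2_iff doubleton_eq_iff)

lemma vertex_profile_Cons:
  assumes "e i = {a, b}" "i \<notin> set xs"
  shows "vertex_profile e (i # xs) a = (insert i (fst (vertex_profile e xs a)), insert i (snd (vertex_profile e xs b)))"
    and "vertex_profile e (i # xs) b = (insert i (fst (vertex_profile e xs b)), insert i (snd (vertex_profile e xs a)))"
    and "v \<notin> {a, b} \<Longrightarrow> vertex_profile e (i # xs) v = vertex_profile e xs v"
  using assms by (auto simp: vertex_profile_def other_end)

lemma forest_profile_remove: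
  "finite C \<Longrightarrow> a \<in> C \<Longrightarrow> forest_profile e xs C = add_mset (vertex_profile e xs a) (forest_profile e xs (C - {a}))"
  by (simp add: forest_profile_def mset_set.remove)

lemma forest_profile_Cons_away:
  assumes "e i \<inter> C = {}"
  shows "forest_profile e (i # xs) C = forest_profile e xs C"
  unfolding forest_profile_def
proof (rule image_mset_cong)
  fix v assume "v \<in># mset_set C"
  then have "v \<in> C" by (metis elem_mset_set empty_iff mset_set.infinite set_mset_empty)
  then have "v \<notin> e i" using assms by auto
  then show "vertex_profile e (i # xs) v = vertex_profile e xs v" by (auto simp: vertex_profile_def)
qed

lemma forest_profile_Un:
  "finite C \<Longrightarrow> finite D \<Longrightarrow> C \<inter> D = {} \<Longrightarrow> forest_profile e xs (C \<union> D) = forest_profile e xs C + forest_profile e xs D"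
  by (simp add: forest_profile_def mset_set_Union)

text \<open>The effect of a new smallest edge on a forest: only the pairs of its two ends change, and these
  exchange their trails.\<close>

lemma forest_profile_join:
  assumes "finite C" "finite D" "a \<in> C" "b \<in> D" "C \<inter> D = {}" "e i = {a, b}" "i \<notin> set xs"
  shows "forest_profile e (i # xs) (C \<union> D) =
    add_mset (insert i (fst (vertex_profile e xs a)), insert i (snd (vertex_profile e xs b)))
      (add_mset (insert i (fst (vertex_profile e xs b)), insert i (snd (vertex_profile e xs a)))
        (forest_profile e xs (C - {a}) + forest_profile e xs (D - {b})))"
proof -
  have "e i \<inter> (C - {a}) = {}" "e i \<inter> (D - {b}) = {}" using assms by auto
  note away = this [THEN forest_profile_Cons_away [of e i]]
  show ?thesis
    unfolding forest_profile_Un [OF assms(1,2,5)] forest_profile_remove [OF assms(1,3)] forest_profile_remove [OF assms(2,4)]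
      away vertex_profile_Cons(1,2) [where e = e and i = i, OF assms(6,7)]
    by simp
qed

definition conn :: "(nat \<Rightarrow> 'a set) \<Rightarrow> nat set \<Rightarrow> ('a \<times> 'a) set" where
  "conn e X = {(x, y). \<exists>j\<in>X. e j = {x, y}}\<^sup>*"

definition component :: "(nat \<Rightarrow> 'a set) \<Rightarrow> nat set \<Rightarrow> 'a \<Rightarrow> 'a set" where
  "component e X v = {w. (v, w) \<in> conn e X}"

lemma conn_refl: "(v, v) \<in> conn e X"
  by (simp add: conn_def)

lemma conn_trans: "(u, v) \<in> conn e X \<Longrightarrow> (v, w) \<in> conn e X \<Longrightarrow> (u, w) \<in> conn e X"
  unfolding conn_def by (rule rtrancl_trans)

lemma conn_sym: "(u, v) \<in> conn e X \<Longrightarrow> (v, u) \<in> conn e X"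
  unfolding conn_def by (rule symD [OF sym_rtrancl]) (auto intro!: symI simp: insert_commute)

lemma conn_edge: "j \<in> X \<Longrightarrow> e j = {a, b} \<Longrightarrow> (a, b) \<in> conn e X"
  unfolding conn_def by auto

lemma conn_mono: "X \<subseteq> Y \<Longrightarrow> (\<And>j. j \<in> X \<Longrightarrow> e j = e' j) \<Longrightarrow> conn e X \<subseteq> conn e' Y"
  unfolding conn_def by (rule rtrancl_mono) auto

lemma component_eq_iff: "component e X u = component e X v \<longleftrightarrow> u \<in> component e X v"
  unfolding component_def using conn_refl conn_trans conn_sym by fast

lemma component_self: "v \<in> component e X v"
  by (simp add: component_def conn_refl)

lemma conn_insert:
  assumes "e i = {a, b}"
  shows "(u, v) \<in> conn e (insert i X) \<longleftrightarrow> (u, v) \<in> conn e X \<or>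
    ((u, a) \<in> conn e X \<or> (u, b) \<in> conn e X) \<and> ((a, v) \<in> conn e X \<or> (b, v) \<in> conn e X)"
proof
  assume "(u, v) \<in> conn e (insert i X)"
  then show "(u, v) \<in> conn e X \<or>
    ((u, a) \<in> conn e X \<or> (u, b) \<in> conn e X) \<and> ((a, v) \<in> conn e X \<or> (b, v) \<in> conn e X)"
    unfolding conn_def [of e "insert i X"]
  proof (induction rule: rtrancl_induct)
    case (step y z)
    then consider "(y, z) \<in> conn e X" | "{y, z} = {a, b}"
      using assms conn_edge [of _ X e] by auto
    then show ?case
    proof cases
      case 1
      then show ?thesis using step.IH conn_trans by metis
    next
      case 2
      then have "z = a \<or> z = b" "y = a \<or> y = b" by (auto simp: doubleton_eq_iff)
      then show ?thesis using step.IH conn_refl by metis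
    qed
  qed (simp add: conn_refl)
next
  have sub: "conn e X \<subseteq> conn e (insert i X)" by (rule conn_mono) auto
  have ab: "(a, b) \<in> conn e (insert i X)" by (rule conn_edge [of i]) (use assms in auto)
  assume "(u, v) \<in> conn e X \<or>
    ((u, a) \<in> conn e X \<or> (u, b) \<in> conn e X) \<and> ((a, v) \<in> conn e X \<or> (b, v) \<in> conn e X)"
  then show "(u, v) \<in> conn e (insert i X)"
    using sub ab conn_trans [of _ _ e "insert i X"] conn_sym [OF ab] by blast
qed

lemma component_insert:
  assumes "e i = {a, b}"
  shows "component e (insert i X) v =
    (if v \<in> component e X a \<union> component e X b then component e X a \<union> component e X b else component e X v)"
proof -
  have mem: "w \<in> component e (insert i X) v \<longleftrightarrow> w \<in> component e X v \<or>
      v \<in> component e X a \<union> component e X b \<and> w \<in> component e X a \<union> component e X b" for w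
    using conn_insert [where e = e and i = i, OF assms, of v w X] conn_sym [of v a e X]
      conn_sym [of a v e X] conn_sym [of v b e X] conn_sym [of b v e X]
    unfolding component_def by simp blast
  have "component e X v \<subseteq> component e X a \<union> component e X b" if "v \<in> component e X a \<union> component e X b"
    using that component_eq_iff [of e X v a] component_eq_iff [of e X v b] by blast
  then show ?thesis using mem by auto
qed

text \<open>Each edge merges at most two components.\<close>

lemma card_le_components:
  assumes "finite X" "finite V" "\<And>i. i \<in> X \<Longrightarrow> card (e i) = 2"
  shows "card V \<le> card (component e X ` V) + card X"
  using assms(1,3)
proof (induction X rule: finite_induct)
  case empty
  have "component e {} = (\<lambda>v. {v})" by (auto simp: component_def conn_def)
  then show ?case by (simp add: card_image)
next
  case (insert i X)
  obtain a b where ab: "e i = {a, b}" using insert.prems [of i] by (auto simp: card_2_iff)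
  define Ca where "Ca = component e X a"
  define Cb where "Cb = component e X b"
  \<comment> \<open>What inserting the edge does to components: it is injective away from one of the two merged ones.\<close>
  define h where "h = (\<lambda>C. if C = Ca \<or> C = Cb then Ca \<union> Cb else C)"
  have "component e (insert i X) v = h (component e X v)" for v
    unfolding component_insert [where e = e and i = i, OF ab] h_def Ca_def Cb_def component_eq_iff by simp
  then have img: "component e (insert i X) ` V = h ` component e X ` V" by (auto simp: image_image)
  have "inj_on h (component e X ` V - {Cb})"
  proof (rule inj_onI)
    fix C D assume C: "C \<in> component e X ` V - {Cb}" and D: "D \<in> component e X ` V - {Cb}" and eq: "h C = h D"
    have *: "E = Ca" if "E \<in> component e X ` V" "E = Ca \<union> Cb" for E
    proof -
      from that(1) obtain c where "E = component e X c" by auto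
      moreover have "a \<in> E" using that(2) component_self by (auto simp: Ca_def)
      ultimately show ?thesis unfolding Ca_def by (simp add: component_eq_iff [of e X a c, symmetric])
    qed
    show "C = D" using C D eq * unfolding h_def by (auto split: if_splits)
  qed
  then have "card (component e X ` V - {Cb}) = card (h ` (component e X ` V - {Cb}))" by (simp add: card_image)
  also have "\<dots> \<le> card (h ` component e X ` V)" using assms(2) by (intro card_mono) auto
  finally have "card (component e X ` V) \<le> card (h ` component e X ` V) + 1"
    using card_Diff1_le [of "component e X ` V" Cb] by (simp add: card_Diff_singleton_if split: if_splits)
  then show ?case using insert img by simp
qed

lemma connected_card_le:
  assumes "finite X" "finite V" "\<And>i. i \<in> X \<Longrightarrow> card (e i) = 2" "V \<times> V \<subseteq> conn e X"
  shows "card V \<le> Suc (card X)"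
proof -
  have "component e X ` V \<subseteq> {component e X v}" if "v \<in> V" for v
  proof -
    have "component e X u = component e X v" if "u \<in> V" for u
      unfolding component_eq_iff using assms(4) that \<open>v \<in> V\<close> by (auto simp: component_def)
    then show ?thesis by auto
  qed
  then have "card (component e X ` V) \<le> 1"
    by (cases "V = {}") (auto dest: card_mono [rotated] simp: subset_singleton_iff)
  then show ?thesis using card_le_components [OF assms(1-3)] by force
qed

text \<open>If the other edges connected the ends of \<open>i\<close>, then they would connect all of \<open>V\<close>, and
  there are too few of them for that.\<close>

lemma edge_is_bridge:
  assumes "finite X" "finite V" "V \<noteq> {}" "\<And>i. i \<in> X \<Longrightarrow> card (e i) = 2" "V \<times> V \<subseteq> conn e X"
    and "card X = card V - 1" "i \<in> X" "e i = {a, b}"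
  shows "(a, b) \<notin> conn e (X - {i})"
proof
  assume ab: "(a, b) \<in> conn e (X - {i})"
  have "conn e X \<subseteq> conn e (X - {i})"
  proof (rule subrelI)
    fix u v assume "(u, v) \<in> conn e X"
    moreover have "insert i (X - {i}) = X" using assms(7) by auto
    ultimately show "(u, v) \<in> conn e (X - {i})"
      using conn_insert [where e = e and i = i, OF assms(8), of u v "X - {i}"] ab conn_sym [OF ab]
        conn_trans [of _ _ e "X - {i}"] by metis
  qed
  then have "card V \<le> Suc (card (X - {i}))"
    using assms by (intro connected_card_le [of _ _ e]) auto
  moreover have "card V > 0" using assms by (simp add: card_gt_0_iff)
  moreover have "card X > 0" using assms by (auto simp: card_gt_0_iff)
  ultimately show False using assms by simp
qed

text \<open>The edges are inserted from the last entry of \<open>xs\<close> to the first.  Since every edge is a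
  bridge, the ends of the new edge lie in different components, and the inductive rule for profiles
  applies to their union.\<close>

lemma profile_component:
  assumes "sorted_wrt (<) xs" "finite V" "v \<in> V"
    "\<And>i. i \<in> set xs \<Longrightarrow> e i \<subseteq> V \<and> card (e i) = 2"
    "\<And>i a b. i \<in> set xs \<Longrightarrow> e i = {a, b} \<Longrightarrow> (a, b) \<notin> conn e (set xs - {i})"
  shows "profile {j \<in> set xs. e j \<subseteq> component e (set xs) v} (forest_profile e xs (component e (set xs) v))"
  using assms
proof (induction xs arbitrary: v)
  case Nil
  have "component e {} v = {v}" by (auto simp: component_def conn_def)
  then show ?case by (simp add: forest_profile_def vertex_profile_def profile.single)
next
  case (Cons i xs)
  let ?X = "set xs"
  have bridge: "(a, b) \<notin> conn e (?X - {j})" if "j \<in> ?X" "e j = {a, b}" for j a b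
    using Cons.prems(5) [of j a b] that conn_mono [of "?X - {j}" "set (i # xs) - {j}" e e] by auto
  have IH: "profile {j \<in> ?X. e j \<subseteq> component e ?X u} (forest_profile e xs (component e ?X u))" if "u \<in> V" for u
    by (rule Cons.IH) (use Cons.prems that bridge in auto)
  have i: "i \<notin> ?X" "\<And>j. j \<in> ?X \<Longrightarrow> i < j" using Cons.prems(1) by auto
  obtain a b where ab: "e i = {a, b}" using Cons.prems(4) [of i] by (auto simp: card_2_iff)
  have abV: "a \<in> V" "b \<in> V" using Cons.prems(4) [of i] ab by auto
  define Ca where "Ca = component e ?X a"
  define Cb where "Cb = component e ?X b"
  have "set (i # xs) - {i} = ?X" using i by auto
  then have "(a, b) \<notin> conn e ?X" using Cons.prems(5) [of i a b] ab by simp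
  then have disj: "Ca \<inter> Cb = {}"
    unfolding Ca_def Cb_def component_def using conn_sym conn_trans by fast
  have inV: "component e ?X u \<subseteq> V" if "u \<in> V" for u
  proof
    fix w assume "w \<in> component e ?X u"
    then have "(u, w) \<in> {(x, y). \<exists>j\<in>?X. e j = {x, y}}\<^sup>*" by (simp add: component_def conn_def)
    then show "w \<in> V"
    proof (induction rule: rtrancl_induct)
      case (step y z)
      then obtain j where "j \<in> ?X" "e j = {y, z}" by auto
      then show ?case using Cons.prems(4) [of j] by auto
    qed (use that in simp)
  qed
  have fin: "finite Ca" "finite Cb"
    unfolding Ca_def Cb_def using inV abV Cons.prems(2) finite_subset by blast+
  have edge: "e j \<subseteq> Ca \<or> e j \<inter> Ca = {}" "e j \<subseteq> Cb \<or> e j \<inter> Cb = {}" if j: "j \<in> ?X" for j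
  proof -
    obtain x y where xy: "e j = {x, y}" using Cons.prems(4) [of j] j by (auto simp: card_2_iff)
    have "(x, y) \<in> conn e ?X" by (rule conn_edge [of j ?X e x y, OF j xy])
    then have "component e ?X x = component e ?X y"
      unfolding component_eq_iff by (simp add: component_def conn_sym)
    then have "x \<in> component e ?X u \<longleftrightarrow> y \<in> component e ?X u" for u
      by (simp add: component_eq_iff [symmetric])
    then show "e j \<subseteq> Ca \<or> e j \<inter> Ca = {}" "e j \<subseteq> Cb \<or> e j \<inter> Cb = {}"
      unfolding Ca_def Cb_def xy by auto
  qed
  have ne: "e j \<noteq> {}" if "j \<in> ?X" for j using Cons.prems(4) [of j] that by auto
  show ?case
  proof (cases "v \<in> Ca \<union> Cb")
    case True
    then have C: "component e (set (i # xs)) v = Ca \<union> Cb"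
      using component_insert [where e = e and i = i, OF ab, of ?X v] by (simp add: Ca_def Cb_def)
    have sel: "a \<in> Ca" "b \<in> Cb" by (simp_all add: Ca_def Cb_def component_self)
    have "{j \<in> set (i # xs). e j \<subseteq> Ca \<union> Cb} = insert i ({j \<in> ?X. e j \<subseteq> Ca} \<union> {j \<in> ?X. e j \<subseteq> Cb})"
    proof -
      have "e j \<subseteq> Ca \<union> Cb \<longleftrightarrow> e j \<subseteq> Ca \<or> e j \<subseteq> Cb" if "j \<in> ?X" for j
        using edge [OF that] ne [OF that] by blast
      moreover have "e i \<subseteq> Ca \<union> Cb" using ab sel by simp
      ultimately show ?thesis by auto
    qed
    moreover have "profile (insert i ({j \<in> ?X. e j \<subseteq> Ca} \<union> {j \<in> ?X. e j \<subseteq> Cb}))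
      (forest_profile e (i # xs) (Ca \<union> Cb))"
      unfolding forest_profile_join [of Ca Cb a b e i xs, OF fin sel disj ab i(1)]
    proof (rule profile.glue)
      show "profile {j \<in> ?X. e j \<subseteq> Ca}
          (add_mset (fst (vertex_profile e xs a), snd (vertex_profile e xs a)) (forest_profile e xs (Ca - {a})))"
        using IH [OF abV(1)] forest_profile_remove [OF fin(1) sel(1), of e xs] by (simp add: Ca_def)
      show "profile {j \<in> ?X. e j \<subseteq> Cb}
          (add_mset (fst (vertex_profile e xs b), snd (vertex_profile e xs b)) (forest_profile e xs (Cb - {b})))"
        using IH [OF abV(2)] forest_profile_remove [OF fin(2) sel(2), of e xs] by (simp add: Cb_def)
      show "{j \<in> ?X. e j \<subseteq> Ca} \<inter> {j \<in> ?X. e j \<subseteq> Cb} = {}" using disj ne by blast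
    qed (use i in auto)
    ultimately show ?thesis unfolding C by simp
  next
    case False
    then have C: "component e (set (i # xs)) v = component e ?X v"
      using component_insert [where e = e and i = i, OF ab, of ?X v] by (simp add: Ca_def Cb_def)
    have "a \<notin> component e ?X v" "b \<notin> component e ?X v"
      using False conn_sym [of v _ e ?X] by (auto simp: Ca_def Cb_def component_def)
    then have "forest_profile e (i # xs) (component e ?X v) = forest_profile e xs (component e ?X v)"
      "{j \<in> set (i # xs). e j \<subseteq> component e ?X v} = {j \<in> ?X. e j \<subseteq> component e ?X v}"
      using ab by (auto intro!: forest_profile_Cons_away)
    then show ?thesis unfolding C using IH [OF Cons.prems(3)] by simp
  qed
qed

text \<open>Edges that do not touch \<open>V\<close> have no effect on trails inside \<open>V\<close>, so each part of a
  disjoint union keeps its profile even when the labels of the parts interleave.\<close>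

lemma vertex_profile_restrict:
  assumes "v \<in> V" "\<And>j. j \<in> set xs \<Longrightarrow> j \<in> L \<Longrightarrow> e j = e' j \<and> e j \<subseteq> V \<and> card (e j) = 2"
    "\<And>j. j \<in> set xs \<Longrightarrow> j \<notin> L \<Longrightarrow> e j \<inter> V = {}"
  shows "vertex_profile e xs v = vertex_profile e' (filter (\<lambda>j. j \<in> L) xs) v"
proof -
  have "{j \<in> set xs. v \<in> e j} = {j \<in> set (filter (\<lambda>j. j \<in> L) xs). v \<in> e' j}"
    using assms by fastforce
  moreover have "trail_set e xs v = trail_set e' (filter (\<lambda>j. j \<in> L) xs) v"
    using assms
  proof (induction xs arbitrary: v)
    case (Cons i xs)
    have inside: "e j = e' j \<and> e j \<subseteq> V \<and> card (e j) = 2" if "j \<in> set xs" "j \<in> L" for j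
      by (rule Cons.prems(2)) (use that in simp_all)
    have outside: "e j \<inter> V = {}" if "j \<in> set xs" "j \<notin> L" for j
      using Cons.prems(3) [of j] that by simp
    note IH = Cons.IH [OF _ inside outside]
    show ?case
    proof (cases "v \<in> e i")
      case True
      then have L: "i \<in> L" using Cons.prems(1) Cons.prems(3) [of i] by auto
      then have i: "e i = e' i" "e i \<subseteq> V" "card (e i) = 2" using Cons.prems(2) [of i] by auto
      obtain w where w: "e i = {v, w}" using card_2_other_end [OF i(3) True] by auto
      then have "w \<in> V" using i(2) by auto
      then show ?thesis using L w IH [of w] by (simp add: other_end i(1) [symmetric])
    next
      case False
      then show ?thesis using Cons.prems(1) Cons.prems(2) [of i] IH by auto
    qed
  qed simp
  ultimately show ?thesis by (simp add: vertex_profile_def)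
qed

section \<open>Isomorphism classes of e-trees and profiles\<close>

lemma sorted_list_of_set_filter_Un:
  fixes L M :: "nat set"
  assumes "finite L" "finite M"
  shows "filter (\<lambda>j. j \<in> L) (sorted_list_of_set (L \<union> M)) = sorted_list_of_set L"
  using assms by (intro sorted_distinct_set_unique) (auto simp: sorted_filter [of id, simplified])

lemma sorted_list_of_set_insert_least:
  fixes L :: "nat set"
  assumes "finite L" "\<And>j. j \<in> L \<Longrightarrow> i < j"
  shows "sorted_list_of_set (insert i L) = i # sorted_list_of_set L"
proof -
  have "i \<notin> L" using assms(2) by blast
  then show ?thesis using assms by (simp add: insort_is_Cons less_imp_le)
qed

lemma vertex_profile_restrict_sorted:
  assumes "finite L" "finite M"
    and "\<And>j. j \<in> L \<Longrightarrow> e j = e' j \<and> e j \<subseteq> V \<and> card (e j) = 2"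
    and "\<And>j. j \<in> M - L \<Longrightarrow> e j \<inter> V = {}" "v \<in> V"
  shows "vertex_profile e (sorted_list_of_set (L \<union> M)) v = vertex_profile e' (sorted_list_of_set L) v"
proof -
  have "vertex_profile e (sorted_list_of_set (L \<union> M)) v =
      vertex_profile e' (filter (\<lambda>j. j \<in> L) (sorted_list_of_set (L \<union> M))) v"
  proof (rule vertex_profile_restrict [OF assms(5)])
    fix j assume j: "j \<in> set (sorted_list_of_set (L \<union> M))"
    show "e j = e' j \<and> e j \<subseteq> V \<and> card (e j) = 2" if "j \<in> L"
      by (rule assms(3) [OF that])
    show "e j \<inter> V = {}" if "j \<notin> L"
      by (rule assms(4)) (use j that assms(1,2) in simp)
  qed
  then show ?thesis by (simp add: sorted_list_of_set_filter_Un assms)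
qed

text \<open>Trees given by connectedness and the number of edges.  In this form the absence of cycles is a
  consequence, and joining two trees is easy to check.\<close>

definition realizes :: "(nat \<Rightarrow> 'a set) \<Rightarrow> nat set \<Rightarrow> 'a set \<Rightarrow> bool" where
  "realizes e L V \<longleftrightarrow> finite V \<and> card V = Suc (card L) \<and> inj_on e L \<and>
     (\<forall>j\<in>L. e j \<subseteq> V \<and> card (e j) = 2) \<and> V \<times> V \<subseteq> conn e L"

text \<open>The set \<open>W\<close> of forbidden vertex names allows the two parts of a join to be realized on
  disjoint vertex sets.\<close>

lemma profile_realized:
  "profile L P \<Longrightarrow> finite W \<Longrightarrow> \<exists>V e. V \<inter> W = {} \<and> realizes e L V \<and>
     forest_profile e (sorted_list_of_set L) (V :: nat set) = P"
proof (induction arbitrary: W rule: profile.induct)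
  case single
  obtain v where "v \<notin> W" using single ex_new_if_finite infinite_UNIV_nat by blast
  then show ?case
    by (intro exI [of _ "{v}"] exI [of _ "\<lambda>_. {}"])
      (simp add: realizes_def conn_refl forest_profile_def vertex_profile_def)
next
  case (glue L1 A A' P1 L2 B B' P2 i)
  have fin: "finite L1" "finite L2" using glue.hyps(1,2) profile_finite by auto
  have i: "i \<notin> L1" "i \<notin> L2" using glue.hyps(4) by blast+
  from glue.IH(1) [OF glue.prems] obtain V1 e1 where V1: "V1 \<inter> W = {}" "realizes e1 L1 V1"
    "forest_profile e1 (sorted_list_of_set L1) V1 = add_mset (A, A') P1" by blast
  have finV1: "finite V1" using V1(2) by (simp add: realizes_def)
  from glue.IH(2) [of "W \<union> V1"] glue.prems finV1 obtain V2 e2 where V2: "V2 \<inter> (W \<union> V1) = {}"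
    "realizes e2 L2 V2" "forest_profile e2 (sorted_list_of_set L2) V2 = add_mset (B, B') P2" by blast
  have finV2: "finite V2" using V2(2) by (simp add: realizes_def)
  have disj: "V1 \<inter> V2 = {}" using V2(1) by auto
  have "(A, A') \<in># forest_profile e1 (sorted_list_of_set L1) V1" using V1(3) by simp
  then obtain a where a: "a \<in> V1" "vertex_profile e1 (sorted_list_of_set L1) a = (A, A')"
    using finV1 by (auto simp: forest_profile_def)
  have "(B, B') \<in># forest_profile e2 (sorted_list_of_set L2) V2" using V2(3) by simp
  then obtain b where b: "b \<in> V2" "vertex_profile e2 (sorted_list_of_set L2) b = (B, B')"
    using finV2 by (auto simp: forest_profile_def)
  define e where "e = (\<lambda>j. if j = i then {a, b} else if j \<in> L1 then e1 j else e2 j)"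
  have ei: "e i = {a, b}" by (simp add: e_def)
  have e1: "e j = e1 j \<and> e j \<subseteq> V1 \<and> card (e j) = 2" if "j \<in> L1" for j
    using V1(2) i that by (auto simp: e_def realizes_def)
  have e2: "e j = e2 j \<and> e j \<subseteq> V2 \<and> card (e j) = 2" if "j \<in> L2" for j
    using V2(2) i glue.hyps(3) that by (auto simp: e_def realizes_def)
  define L where "L = L1 \<union> L2"
  define xs where "xs = sorted_list_of_set L"
  have "sorted_list_of_set (insert i L) = i # xs"
    unfolding xs_def by (rule sorted_list_of_set_insert_least) (use fin glue.hyps(4) L_def in auto)
  moreover have "i \<notin> set xs"
    unfolding xs_def using fin i by (simp add: L_def)
  ultimately have xs: "sorted_list_of_set (insert i L) = i # xs" "i \<notin> set xs" .
  have vp1: "vertex_profile e xs v = vertex_profile e1 (sorted_list_of_set L1) v" if "v \<in> V1" for v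
    unfolding xs_def L_def
    by (rule vertex_profile_restrict_sorted [OF fin e1 _ that]) (use e2 disj in auto)
  have vp2: "vertex_profile e xs v = vertex_profile e2 (sorted_list_of_set L2) v" if "v \<in> V2" for v
    unfolding xs_def L_def Un_commute [of L1 L2]
    by (rule vertex_profile_restrict_sorted [OF fin(2,1) e2 _ that]) (use e1 disj in auto)
  have "forest_profile e xs V1 = forest_profile e1 (sorted_list_of_set L1) V1"
    unfolding forest_profile_def by (rule image_mset_cong) (use vp1 finV1 in simp)
  then have p1: "forest_profile e xs (V1 - {a}) = P1"
    using forest_profile_remove [OF finV1 a(1), of e xs] V1(3) vp1 [OF a(1)] a(2) by simp
  have "forest_profile e xs V2 = forest_profile e2 (sorted_list_of_set L2) V2"
    unfolding forest_profile_def by (rule image_mset_cong) (use vp2 finV2 in simp)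
  then have p2: "forest_profile e xs (V2 - {b}) = P2"
    using forest_profile_remove [OF finV2 b(1), of e xs] V2(3) vp2 [OF b(1)] b(2) by simp
  have "forest_profile e (sorted_list_of_set (insert i L)) (V1 \<union> V2) =
    add_mset (insert i A, insert i B') (add_mset (insert i B, insert i A') (P1 + P2))"
    unfolding xs(1) forest_profile_join [of V1 V2 a b e i xs, OF finV1 finV2 a(1) b(1) disj ei xs(2)]
    by (simp add: p1 p2 vp1 [OF a(1)] vp2 [OF b(1)] a(2) b(2))
  moreover have "realizes e (insert i L) (V1 \<union> V2)"
    unfolding realizes_def
  proof (intro conjI ballI)
    show "finite (V1 \<union> V2)" using finV1 finV2 by simp
    show "card (V1 \<union> V2) = Suc (card (insert i L))"
      using V1(2) V2(2) disj finV1 finV2 fin i glue.hyps(3)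
      by (simp add: card_Un_disjoint realizes_def L_def)
    show "inj_on e (insert i L)"
    proof (rule inj_onI)
      fix j k assume jk: "j \<in> insert i L" "k \<in> insert i L" "e j = e k"
      have cross: "\<not> e i \<subseteq> V1" "\<not> e i \<subseteq> V2" using ei a(1) b(1) disj by auto
      have ne: "e l \<noteq> {}" if "l \<in> L1 \<union> L2" for l using e1 [of l] e2 [of l] that by auto
      have nodisj: "\<not> (e l \<subseteq> V1 \<and> e l \<subseteq> V2)" if "l \<in> L1 \<union> L2" for l using ne [OF that] disj by blast
      consider "j = i" "k = i" | "j = i" "k \<in> L" | "j \<in> L" "k = i" | "j \<in> L1" "k \<in> L1" | "j \<in> L2" "k \<in> L2"
        | "j \<in> L1" "k \<in> L2" | "j \<in> L2" "k \<in> L1" using jk(1,2) by (auto simp: L_def)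
      then show "j = k"
      proof cases
        case 2
        then show ?thesis using e1 [of k] e2 [of k] cross jk(3) by (auto simp: L_def)
      next
        case 3
        then show ?thesis using e1 [of j] e2 [of j] cross jk(3) by (auto simp: L_def)
      next
        case 4
        then show ?thesis using e1 [of j] e1 [of k] jk(3) V1(2) by (auto simp: realizes_def dest: inj_onD)
      next
        case 5
        then show ?thesis using e2 [of j] e2 [of k] jk(3) V2(2) by (auto simp: realizes_def dest: inj_onD)
      next
        case 6
        then have "e j \<subseteq> V1" "e k \<subseteq> V2" using e1 [of j] e2 [of k] by auto
        then show ?thesis using nodisj [of j] 6 jk(3) by auto
      next
        case 7
        then have "e j \<subseteq> V2" "e k \<subseteq> V1" using e2 [of j] e1 [of k] by auto
        then show ?thesis using nodisj [of j] 7 jk(3) by auto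
      qed simp
    qed
    have "a \<noteq> b" using a(1) b(1) disj by auto
    then show "e j \<subseteq> V1 \<union> V2" "card (e j) = 2" if "j \<in> insert i L" for j
      using that e1 [of j] e2 [of j] ei a(1) b(1) by (auto simp: L_def)
    show "(V1 \<union> V2) \<times> (V1 \<union> V2) \<subseteq> conn e (insert i L)"
    proof -
      let ?R = "conn e (insert i L)"
      have ab: "(a, b) \<in> ?R" by (rule conn_edge [of i]) (simp_all add: ei)
      have "conn e1 L1 \<subseteq> ?R" "conn e2 L2 \<subseteq> ?R"
        by (rule conn_mono; use e1 e2 in \<open>auto simp: L_def\<close>)+
      then have "V1 \<times> V1 \<subseteq> ?R" "V2 \<times> V2 \<subseteq> ?R" using V1(2) V2(2) by (auto simp: realizes_def)
      then have to_a: "(v, a) \<in> ?R" if "v \<in> V1 \<union> V2" for v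
        using that a(1) b(1) conn_trans [OF _ conn_sym [OF ab], of v] by blast
      then show ?thesis using conn_trans [OF to_a conn_sym [OF to_a]] by blast
    qed
  qed
  moreover have "(V1 \<union> V2) \<inter> W = {}" using V1(1) V2(1) by auto
  ultimately show ?case unfolding L_def by blast
qed

lemma adj_eq: "{(x, y). {x, y} \<in> e ` X} = {(x, y). \<exists>j\<in>X. e j = {x, y}}"
  by auto

lemma set_upt_labels: "set [1..<card (verts t)] = labels t"
  by (auto simp: labels_def)

text \<open>The remaining edges of a cycle would connect the two ends of its closing edge.\<close>

lemma realizes_no_cycle:
  assumes "realizes e L V" "finite L" "V \<noteq> {}"
  shows "\<not> graph_cycle (e ` L) p"
proof
  assume cyc: "graph_cycle (e ` L) p"
  let ?n = "length p"
  have len: "?n \<ge> 3" and dist: "distinct p" using cyc by (auto simp: graph_cycle_def)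
  have edge: "{p ! k, p ! (Suc k mod ?n)} \<in> e ` L" if "k < ?n" for k
    using cyc that by (auto simp: graph_cycle_def)
  have "{p ! (?n - 1), p ! 0} \<in> e ` L"
  proof -
    have "Suc (?n - 1) = ?n" "?n - 1 < ?n" using len by auto
    then show ?thesis using edge [of "?n - 1"] by simp
  qed
  then obtain i where i: "i \<in> L" "e i = {p ! (?n - 1), p ! 0}" by auto
  have "(p ! 0, p ! k) \<in> conn e (L - {i})" if "k < ?n" for k
    using that
  proof (induction k)
    case (Suc k)
    have "{p ! k, p ! Suc k} \<in> e ` L" using edge [of k] Suc.prems by simp
    then obtain j where j: "j \<in> L" "e j = {p ! k, p ! Suc k}" by auto
    have "j \<noteq> i"
    proof
      assume "j = i"
      then have "{p ! k, p ! Suc k} = {p ! (?n - 1), p ! 0}" using i j by simp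
      then have "p ! k = p ! 0 \<and> p ! Suc k = p ! (?n - 1)"
        using dist Suc.prems len by (auto simp: doubleton_eq_iff nth_eq_iff_index_eq)
      moreover have kn: "k < ?n" "0 < ?n" "Suc k < ?n" "?n - 1 < ?n" using Suc.prems len by auto
      ultimately have "k = 0" "Suc k = ?n - 1"
        using nth_eq_iff_index_eq [OF dist kn(1,2)] nth_eq_iff_index_eq [OF dist kn(3,4)] by auto
      then show False using len by simp
    qed
    then have "(p ! k, p ! Suc k) \<in> conn e (L - {i})" using j by (intro conn_edge [of j]) auto
    then show ?case using Suc conn_trans by (metis Suc_lessD)
  qed (simp add: conn_refl)
  then have "(p ! 0, p ! (?n - 1)) \<in> conn e (L - {i})" using len by simp
  then have "(p ! (?n - 1), p ! 0) \<in> conn e (L - {i})" by (rule conn_sym)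
  then show False
    using edge_is_bridge [of L V e i "p ! (?n - 1)" "p ! 0"] assms i by (auto simp: realizes_def)
qed

lemma is_etree_iff_realizes: "is_etree t \<longleftrightarrow> verts t \<noteq> {} \<and> realizes (ends t) (labels t) (verts t)"
proof -
  have "card (verts t) = Suc (card (labels t))" if "finite (verts t)" "verts t \<noteq> {}"
    using that by (simp add: labels_def card_gt_0_iff Suc_diff_le)
  moreover have "finite (labels t)" by (simp add: labels_def)
  ultimately show ?thesis
    using realizes_no_cycle [of "ends t" "labels t" "verts t"]
    unfolding is_etree_def is_tree_def simple_graph_def graph_connected_def adj_eq realizes_def conn_def
    by auto
qed

definition tree_profile :: "'a etree \<Rightarrow> (nat set \<times> nat set) multiset" where
  "tree_profile t = forest_profile (ends t) [1..<card (verts t)] (verts t)"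

lemma profile_tree_profile:
  assumes "is_etree t"
  shows "profile (labels t) (tree_profile t)"
proof -
  have r: "verts t \<noteq> {}" "realizes (ends t) (labels t) (verts t)" using assms by (auto simp: is_etree_iff_realizes)
  then obtain v where v: "v \<in> verts t" by blast
  have edges: "ends t i \<subseteq> verts t \<and> card (ends t i) = 2" if "i \<in> labels t" for i
    using r that by (simp add: realizes_def)
  have "profile {j \<in> labels t. ends t j \<subseteq> component (ends t) (labels t) v}
      (forest_profile (ends t) [1..<card (verts t)] (component (ends t) (labels t) v))"
    unfolding set_upt_labels [symmetric]
  proof (rule profile_component [OF _ _ v])
    show "(a, b) \<notin> conn (ends t) (set [1..<card (verts t)] - {i})"
      if "i \<in> set [1..<card (verts t)]" "ends t i = {a, b}" for i a b
      unfolding set_upt_labels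
      by (rule edge_is_bridge [of _ "verts t"])
        (use that r in \<open>auto simp: realizes_def set_upt_labels simp flip: set_upt_labels\<close>)
    show "ends t i \<subseteq> verts t \<and> card (ends t i) = 2" if "i \<in> set [1..<card (verts t)]" for i
      by (rule edges) (use that set_upt_labels in blast)
    show "finite (verts t)" using r by (simp add: realizes_def)
  qed (rule sorted_wrt_upt)
  moreover have "component (ends t) (labels t) v = verts t"
  proof
    show "component (ends t) (labels t) v \<subseteq> verts t"
    proof
      fix w assume "w \<in> component (ends t) (labels t) v"
      then have "(v, w) \<in> {(x, y). \<exists>j\<in>labels t. ends t j = {x, y}}\<^sup>*" by (simp add: component_def conn_def)
      then show "w \<in> verts t"
      proof (induction rule: rtrancl_induct)
        case (step y z)
        then obtain j where "j \<in> labels t" "ends t j = {y, z}" by auto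
        then show ?case using edges [of j] by auto
      qed (rule v)
    qed
    show "verts t \<subseteq> component (ends t) (labels t) v" using r v by (auto simp: realizes_def component_def)
  qed
  moreover have "{j \<in> labels t. ends t j \<subseteq> verts t} = labels t" using edges by auto
  ultimately show ?thesis by (simp add: tree_profile_def)
qed

lemma tree_profile_onto:
  assumes "profile {1..n - 1} P" "n \<ge> 1"
  obtains t :: "nat etree" where "is_etree t" "card (verts t) = n" "tree_profile t = P"
proof -
  obtain V e where V: "realizes e {1..n - 1} V" "forest_profile e (sorted_list_of_set {1..n - 1}) (V :: nat set) = P"
    using profile_realized [OF assms(1), of "{}"] by auto
  have n: "card V = n" using V(1) assms(2) by (simp add: realizes_def)
  have "sorted_list_of_set {1..n - 1} = [1..<n]"
    using assms(2) by (intro sorted_distinct_set_unique) auto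
  then have "tree_profile \<lparr>verts = V, ends = e\<rparr> = P"
    using V(2) n by (simp add: tree_profile_def)
  moreover have "is_etree \<lparr>verts = V, ends = e\<rparr>"
    using V(1) n assms(2) by (auto simp: is_etree_iff_realizes labels_def)
  ultimately show ?thesis using that n by simp
qed

text \<open>Going through the labels one by one: at the label \<open>Suc k\<close> the greedy trail either uses this
  edge, which is then the minimum of the admissible ones, or the admissible set is the same for the
  bound \<open>Suc k\<close>.\<close>

lemma trail_set_greedy:
  "trail_set (ends t) [Suc k..<card (verts t)] v = fst ` set (greedy t k v)"
proof (induction "card (verts t) - k" arbitrary: k v)
  case 0
  then have "{i \<in> labels t. k < i \<and> v \<in> ends t i} = {}" by (auto simp: labels_def)
  then show ?case using 0 by (subst greedy.simps) (simp add: Let_def)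
next
  case (Suc d)
  show ?case
  proof (cases "Suc k < card (verts t)")
    case False
    then have "{i \<in> labels t. k < i \<and> v \<in> ends t i} = {}" by (auto simp: labels_def)
    then show ?thesis using False by (subst greedy.simps) (simp add: Let_def)
  next
    case True
    have IH: "trail_set (ends t) [Suc (Suc k)..<card (verts t)] w = fst ` set (greedy t (Suc k) w)" for w
      using Suc.hyps by (intro Suc.hyps(1)) simp
    have upt: "[Suc k..<card (verts t)] = Suc k # [Suc (Suc k)..<card (verts t)]"
      using True by (simp add: upt_conv_Cons)
    let ?S = "\<lambda>k. {i \<in> labels t. k < i \<and> v \<in> ends t i}"
    show ?thesis
    proof (cases "v \<in> ends t (Suc k)")
      case v: True
      have "Suc k \<in> ?S k" using v True by (auto simp: labels_def)
      moreover have "Min (?S k) = Suc k"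
        using calculation by (intro Min_eqI) (auto simp: labels_def)
      ultimately have "greedy t k v = (Suc k, THE w. ends t (Suc k) = {v, w}) #
          greedy t (Suc k) (THE w. ends t (Suc k) = {v, w})"
        by (subst greedy.simps) (auto simp: Let_def)
      then show ?thesis unfolding upt using v IH by simp
    next
      case v: False
      have S: "?S k = ?S (Suc k)" using v by (auto simp: le_less Suc_le_eq dest: Suc_leI)
      have "greedy t k v = greedy t (Suc k) v"
        unfolding greedy.simps [of t k v] greedy.simps [of t "Suc k" v] S ..
      then show ?thesis unfolding upt using v IH by simp
    qed
  qed
qed

lemma vertex_profile_tree:
  "vertex_profile (ends t) [1..<card (verts t)] v = ({i \<in> labels t. v \<in> ends t i}, trail_labels (migt t v))"
  unfolding vertex_profile_def set_upt_labels trail_labels_def migt_def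
  using trail_set_greedy [of t 0 v] by simp

lemma image_mset_eq_imp_bij_betw:
  assumes "finite V" "finite W" "image_mset f (mset_set V) = image_mset g (mset_set W)"
  obtains h where "bij_betw h V W" "\<And>v. v \<in> V \<Longrightarrow> f v = g (h v)"
proof -
  have "card V = card W" using arg_cong [OF assms(3), of size] by simp
  then obtain k where k: "bij_betw k V W" using assms finite_same_card_bij by blast
  have "mset_set W = image_mset k (mset_set V)"
    using k by (metis bij_betw_def image_mset_mset_set)
  then have "image_mset f (mset_set V) = image_mset (g \<circ> k) (mset_set V)"
    using assms(3) by (simp add: image_mset.compositionality)
  then obtain p where p: "p permutes V" "\<forall>v\<in>V. f v = (g \<circ> k) (p v)"
    using image_mset_eq_implies_permutes [OF assms(1)] by blast
  have "bij_betw (k \<circ> p) V W" using permutes_imp_bij [OF p(1)] k by (rule bij_betw_trans)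
  then show ?thesis using that p(2) by simp
qed

lemma bij_betw_image_mset:
  assumes "bij_betw h V W" "\<And>v. v \<in> V \<Longrightarrow> f v = g (h v)"
  shows "image_mset f (mset_set V) = image_mset g (mset_set W)"
proof -
  have "image_mset g (mset_set W) = image_mset g (image_mset h (mset_set V))"
    using assms(1) by (metis bij_betw_def image_mset_mset_set)
  also have "\<dots> = image_mset f (mset_set V)"
    unfolding image_mset.compositionality using assms(2)
    by (intro image_mset_cong) (metis comp_apply elem_mset_set empty_iff mset_set.infinite set_mset_empty)
  finally show ?thesis by simp
qed

definition tree_star :: "'a etree \<Rightarrow> 'a \<Rightarrow> nat set" where
  "tree_star t v = {i \<in> labels t. v \<in> ends t i}"

lemma fst_tree_profile: "image_mset fst (tree_profile t) = image_mset (tree_star t) (mset_set (verts t))"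
  unfolding tree_profile_def forest_profile_def image_mset.compositionality
  by (rule image_mset_cong) (simp only: o_apply vertex_profile_tree fst_conv tree_star_def)

lemma snd_tree_profile:
  "image_mset snd (tree_profile t) = image_mset (\<lambda>v. trail_labels (migt t v)) (mset_set (verts t))"
  unfolding tree_profile_def forest_profile_def image_mset.compositionality
  by (rule image_mset_cong) (simp only: o_apply vertex_profile_tree snd_conv)

lemma etree_ends: "is_etree t \<Longrightarrow> i \<in> labels t \<Longrightarrow> ends t i = {v \<in> verts t. i \<in> tree_star t v}"
  by (auto simp: is_etree_iff_realizes realizes_def tree_star_def)

lemma trail_labels_subset:
  assumes "is_etree t" "v \<in> verts t"
  shows "trail_labels (migt t v) \<subseteq> labels t"
proof -
  have "finite (verts t)" using assms(1) by (simp add: is_etree_iff_realizes realizes_def)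
  then have "vertex_profile (ends t) [1..<card (verts t)] v \<in># tree_profile t"
    unfolding tree_profile_def forest_profile_def using assms(2) by auto
  then show ?thesis
    unfolding vertex_profile_tree using profile_subset [OF profile_tree_profile [OF assms(1)]] by blast
qed

text \<open>A bijection that preserves stars maps the ends of every edge to the ends of the edge with the
  same label, since the edge \<open>i\<close> consists of the vertices whose star contains \<open>i\<close>.\<close>

lemma etree_iso_if_stars:
  assumes "is_etree t" "is_etree t'"
    and stars: "image_mset fst (tree_profile t) = image_mset fst (tree_profile t')"
  shows "etree_iso t t'"
proof -
  have "finite (verts t)" "finite (verts t')" using assms(1,2) by (auto simp: is_etree_iff_realizes realizes_def)
  then obtain h where h: "bij_betw h (verts t) (verts t')" "\<And>v. v \<in> verts t \<Longrightarrow> tree_star t v = tree_star t' (h v)"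
    using image_mset_eq_imp_bij_betw stars unfolding fst_tree_profile by blast
  have lab: "labels t' = labels t" using bij_betw_same_card [OF h(1)] by (simp add: labels_def)
  have "ends t' i = h ` ends t i" if "i \<in> labels t" for i
  proof -
    have "h ` ends t i = h ` {v \<in> verts t. i \<in> tree_star t' (h v)}"
      unfolding etree_ends [OF assms(1) that] using h(2) by (intro arg_cong [where f = "image h"]) auto
    also have "\<dots> = {w \<in> h ` verts t. i \<in> tree_star t' w}" by auto
    also have "\<dots> = ends t' i"
      using etree_ends [OF assms(2), of i] that lab h(1) by (simp add: bij_betw_def)
    finally show ?thesis by simp
  qed
  then show "etree_iso t t'" using h(1) by (auto simp: etree_iso_def)
qed

lemma etree_iso_imp_tree_profile_eq:
  assumes "is_etree t" "etree_iso t t'"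
  shows "tree_profile t = tree_profile t'"
proof -
  obtain f where f: "bij_betw f (verts t) (verts t')" "\<And>i. i \<in> labels t \<Longrightarrow> ends t' i = f ` ends t i"
    using assms(2) by (auto simp: etree_iso_def)
  have card: "card (verts t') = card (verts t)" using bij_betw_same_card [OF f(1)] by simp
  have edges: "ends t i \<subseteq> verts t" "card (ends t i) = 2" if "i \<in> labels t" for i
    using assms(1) that by (auto simp: is_etree_iff_realizes realizes_def)
  have mem: "v \<in> ends t i \<longleftrightarrow> f v \<in> ends t' i" if "i \<in> labels t" "v \<in> verts t" for i v
    using f that edges [OF that(1)] by (auto simp: bij_betw_def dest: inj_onD)
  have trail: "trail_set (ends t) xs v = trail_set (ends t') xs (f v)" if "set xs \<subseteq> labels t" "v \<in> verts t" for xs v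
    using that
  proof (induction xs arbitrary: v)
    case (Cons i xs)
    show ?case
    proof (cases "v \<in> ends t i")
      case True
      obtain w where w: "ends t i = {v, w}" using card_2_other_end [of "ends t i" v] edges [of i] Cons.prems True by auto
      then have "ends t' i = {f v, f w}" using f(2) [of i] Cons.prems by simp
      moreover have "w \<in> verts t" using w edges [of i] Cons.prems by auto
      ultimately show ?thesis using w Cons by (simp add: other_end)
    next
      case False
      then show ?thesis using mem [of i v] Cons by simp
    qed
  qed simp
  show ?thesis
    unfolding tree_profile_def forest_profile_def card
  proof (rule bij_betw_image_mset [OF f(1)])
    fix v assume v: "v \<in> verts t"
    have "set [1..<card (verts t)] \<subseteq> labels t" by (simp only: set_upt_labels order_refl)
    from trail [OF this v] mem [OF _ v]
    show "vertex_profile (ends t) [1..<card (verts t)] v = vertex_profile (ends t') [1..<card (verts t)] (f v)"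
      unfolding vertex_profile_def set_upt_labels by auto
  qed
qed

text \<open>In the dual, the star of the trail from \<open>v\<close> is the label set of that trail.  So an
  isomorphism from the dual to \<open>t\<close> is a bijection on the vertices that turns trail sets into
  stars.\<close>

lemma self_dual_iff:
  assumes "is_etree t"
  shows "self_dual t \<longleftrightarrow> image_mset fst (tree_profile t) = image_mset snd (tree_profile t)"
proof -
  have fin: "finite (verts t)" using assms by (auto simp: is_etree_iff_realizes realizes_def)
  have inj: "inj_on (migt t) (verts t)" by (rule inj_onI) (simp add: migt_def)
  have bij: "bij_betw (migt t) (verts t) (migt t ` verts t)" using inj by (simp add: bij_betw_def)
  have lab: "labels (dual t) = labels t" by (simp add: labels_def dual_def card_image [OF inj])
  show ?thesis unfolding fst_tree_profile snd_tree_profile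
  proof
    assume "self_dual t"
    then obtain f where f: "bij_betw f (migt t ` verts t) (verts t)"
      "\<And>i. i \<in> labels t \<Longrightarrow> ends t i = f ` {m \<in> migt t ` verts t. i \<in> trail_labels m}"
      unfolding self_dual_def etree_iso_def lab by (auto simp: dual_def)
    have h: "bij_betw (f \<circ> migt t) (verts t) (verts t)" using bij f(1) by (rule bij_betw_trans)
    show "image_mset (tree_star t) (mset_set (verts t)) =
        image_mset (\<lambda>v. trail_labels (migt t v)) (mset_set (verts t))"
    proof (rule bij_betw_image_mset [OF h, symmetric])
      fix v assume v: "v \<in> verts t"
      have "i \<in> trail_labels (migt t v) \<longleftrightarrow> f (migt t v) \<in> ends t i" if "i \<in> labels t" for i
        using f(2) [OF that] f(1) v by (auto simp: bij_betw_def dest: inj_onD)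
      then show "trail_labels (migt t v) = tree_star t ((f \<circ> migt t) v)"
        using trail_labels_subset [OF assms v] by (auto simp: tree_star_def)
    qed
  next
    assume "image_mset (tree_star t) (mset_set (verts t)) =
        image_mset (\<lambda>v. trail_labels (migt t v)) (mset_set (verts t))"
    then obtain h where h: "bij_betw h (verts t) (verts t)"
      "\<And>v. v \<in> verts t \<Longrightarrow> trail_labels (migt t v) = tree_star t (h v)"
      using image_mset_eq_imp_bij_betw [OF fin fin, of "\<lambda>v. trail_labels (migt t v)" "tree_star t"] by metis
    have fst_bij: "bij_betw fst (migt t ` verts t) (verts t)"
      unfolding bij_betw_def by (auto simp: inj_on_def migt_def image_image)
    have "bij_betw (h \<circ> fst) (migt t ` verts t) (verts t)" using fst_bij h(1) by (rule bij_betw_trans)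
    moreover have "ends t i = (h \<circ> fst) ` {m \<in> migt t ` verts t. i \<in> trail_labels m}" if i: "i \<in> labels t" for i
    proof -
      have "(h \<circ> fst) ` {m \<in> migt t ` verts t. i \<in> trail_labels m} =
          h ` {v \<in> verts t. i \<in> trail_labels (migt t v)}"
        by (force simp: migt_def)
      also have "\<dots> = h ` {v \<in> verts t. i \<in> tree_star t (h v)}" using h(2) by auto
      also have "\<dots> = {v \<in> h ` verts t. i \<in> tree_star t v}" by auto
      also have "\<dots> = ends t i" using h(1) etree_ends [OF assms i] by (simp add: bij_betw_def)
      finally show ?thesis by simp
    qed
    ultimately show "self_dual t" unfolding self_dual_def etree_iso_def lab by (auto simp: dual_def)
  qed
qed

lemma tree_profile_image:
  assumes "n \<ge> 1"
  shows "tree_profile ` self_dual_etrees n = self_dual_profiles {1..n - 1}"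
proof (intro equalityI subsetI)
  fix P assume "P \<in> tree_profile ` self_dual_etrees n"
  then obtain t where "t \<in> self_dual_etrees n" and P: "P = tree_profile t" by blast
  then have t: "is_etree t" "card (verts t) = n" "self_dual t" by (simp_all add: self_dual_etrees_def)
  then show "P \<in> self_dual_profiles {1..n - 1}"
    using profile_tree_profile [OF t(1)] self_dual_iff [OF t(1)] unfolding P by (simp add: self_dual_profiles_def labels_def)
next
  fix P assume P: "P \<in> self_dual_profiles {1..n - 1}"
  then obtain t :: "nat etree" where t: "is_etree t" "card (verts t) = n" "tree_profile t = P"
    using tree_profile_onto assms self_dual_profilesD by metis
  then have "t \<in> self_dual_etrees n"
    using P self_dual_iff [OF t(1)] by (simp add: self_dual_etrees_def self_dual_profiles_def)
  then show "P \<in> tree_profile ` self_dual_etrees n" using t(3) by blast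
qed

lemma quotient_kernel:
  "bij_betw (\<lambda>p. {t \<in> S. f t = p}) (f ` S) (S // {(t, t'). t \<in> S \<and> t' \<in> S \<and> f t = f t'})"
proof -
  let ?r = "{(t, t'). t \<in> S \<and> t' \<in> S \<and> f t = f t'}"
  have "?r `` {x} = {t \<in> S. f t = f x}" if "x \<in> S" for x using that by auto
  then have "S // ?r = (\<lambda>p. {t \<in> S. f t = p}) ` f ` S"
    unfolding quotient_def image_image by auto
  moreover have "inj_on (\<lambda>p. {t \<in> S. f t = p}) (f ` S)" by (auto simp: inj_on_def)
  ultimately show ?thesis by (simp add: bij_betw_def)
qed

theorem corollary5p13:
  fixes n :: nat
  assumes "n \<ge> 1"
  shows "finite (self_dual_iso_classes n) \<and> card (self_dual_iso_classes n) = euler_up_down (n - 1)"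
proof -
  have iso: "etree_iso t t' \<longleftrightarrow> tree_profile t = tree_profile t'"
    if "t \<in> self_dual_etrees n" "t' \<in> self_dual_etrees n" for t t'
    using that etree_iso_if_stars [of t t'] etree_iso_imp_tree_profile_eq [of t t']
    by (auto simp: self_dual_etrees_def)
  have rel: "{(t, t'). t \<in> self_dual_etrees n \<and> t' \<in> self_dual_etrees n \<and> etree_iso t t'} =
      {(t, t'). t \<in> self_dual_etrees n \<and> t' \<in> self_dual_etrees n \<and> tree_profile t = tree_profile t'}"
    using iso by auto
  have bij: "bij_betw (\<lambda>P. {t \<in> self_dual_etrees n. tree_profile t = P})
      (self_dual_profiles {1..n - 1}) (self_dual_iso_classes n)"
    unfolding self_dual_iso_classes_def rel tree_profile_image [OF assms, symmetric] by (rule quotient_kernel)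
  have "finite (self_dual_iso_classes n)"
    using bij_betw_finite [OF bij] by (simp add: finite_self_dual_profiles)
  moreover have "card (self_dual_iso_classes n) = euler_up_down (n - 1)"
    using bij_betw_same_card [OF bij] by (simp add: card_self_dual_profiles euler_up_down_eq_zigzag)
  ultimately show ?thesis ..
qed

end
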